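(* Let $E$ be a Polish space and let $\alpha:\mathcal{P}(E)\to(-\infty,\infty]$ be convex, not identically $\infty$, and such that $\{\nu\in\mathcal{P}(E):\alpha(\nu)\le c\}$ is compact for every $c\in\mathbb{R}$. Let $\rho_n$ be the functional associated with $\alpha$ (defined in the context). Then for every bounded continuous function $F:\mathcal{P}(E)\to\mathbb{R}$, $$\lim_{n\to\infty}\frac1n\rho_n(nF\circ L_n)=\sup_{\nu\in\mathcal{P}(E)}\big(F(\nu)-\alpha(\nu)\big).$$
   Context: $\mathcal{P}(E)$ is the set of Borel probability measures on $E$ with the topology of weak convergence. $B(E^n)$ is the set of bounded Borel measurable functions $E^n\to\mathbb{R}$. For $\nu\in\mathcal{P}(E^n)$ define $\nu_{0,1}\in\mathcal{P}(E)$ and measurable maps $\nu_{k-1,k}:E^{k-1}\to\mathcal{P}(E)$, $k=2,\dots,n$ (unique up to $\nu$-a.s. equality), by the disintegration $\nu(dx_1,\dots,dx_n)=\nu_{0,1}(dx_1)\prod_{k=2}^n\nu_{k-1,k}(x_1,\dots,x_{k-1})(dx_k)$. Define $\alpha_n:\mathcal{P}(E^n)\to(-\infty,\infty]$ by $$\alpha_n(\nu)=\int_{E^n}\sum_{k=1}^n\alpha(\nu_{k-1,k}(x_1,\dots,x_{k-1}))\,\nu(dx_1,\dots,dx_n)$$ (the $k=1$ term is $\alpha(\nu_{0,1})$), and $\rho_n:B(E^n)\to\mathbb{R}$ by $$\rho_n(f)=\sup_{\nu\in\mathcal{P}(E^n)}\Big(\int_{E^n}f\,d\nu-\alpha_n(\nu)\Big).$$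 The empirical measure map $L_n:E^n\to\mathcal{P}(E)$ is $L_n(x_1,\dots,x_n)=\frac1n\sum_{i=1}^n\delta_{x_i}$. *)

theory Defs
  imports "HOL-Probability.Probability"
begin

text \<open>
  The set of Borel probability measures on \<open>E\<close> is \<open>space (prob_algebra borel)\<close>.
  The product \<open>E\<^sup>n\<close> is modelled by the extensional functions on \<open>{0..<n}\<close>, with
  coordinates indexed from 0 and the product sigma-algebra, which is the Borel one
  since \<open>E\<close> is second countable.
\<close>

abbreviation probs :: "'a::topological_space measure set" where
  "probs \<equiv> space (prob_algebra borel)"

abbreviation power_space :: "nat \<Rightarrow> (nat \<Rightarrow> 'a::topological_space) measure" where
  "power_space n \<equiv> PiM {0..<n} (\<lambda>_. borel)"

text \<open>The coarsest topology on \<open>probs\<close> for which \<open>\<mu> \<mapsto> \<integral> f d\<mu>\<close> is continuous for every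
  bounded continuous \<open>f\<close>.\<close>

definition weak_topology :: "'a::topological_space measure topology" where
  "weak_topology = topology_generated_by
     {{\<mu> \<in> probs. (\<integral>x. f x \<partial>\<mu>) \<in> U} | (f :: 'a \<Rightarrow> real) U.
        continuous_on UNIV f \<and> bounded (range f) \<and> open U}"

lemma topspace_weak_topology [simp]: "topspace weak_topology = probs"
proof -
  have "\<exists>(f :: 'a \<Rightarrow> real) U. probs = {\<mu> \<in> probs. (\<integral>x. f x \<partial>\<mu>) \<in> U} \<and>
      continuous_on UNIV f \<and> bounded (range f) \<and> open U"
    by (intro exI[of _ "\<lambda>_. 0"] exI[of _ UNIV]) auto
  then show ?thesis
    unfolding weak_topology_def topology_generated_by_topspace by (intro equalityI) blast+
qed

definition convex_comb ::
    "real \<Rightarrow> 'a::topological_space measure \<Rightarrow> 'a measure \<Rightarrow> 'a measure" where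
  "convex_comb t \<mu> \<nu> = measure_of UNIV (sets borel)
     (\<lambda>A. ennreal t * emeasure \<mu> A + ennreal (1 - t) * emeasure \<nu> A)"

lemma emeasure_convex_comb:
  assumes "\<mu> \<in> probs" "\<nu> \<in> probs" "A \<in> sets borel"
  shows "emeasure (convex_comb t \<mu> \<nu>) A
    = ennreal t * emeasure \<mu> A + ennreal (1 - t) * emeasure \<nu> A"
  unfolding convex_comb_def
proof (rule emeasure_measure_of_sigma)
  show "sigma_algebra UNIV (sets (borel :: 'a measure))"
    using sets.sigma_algebra_axioms[of "borel :: 'a measure"] by simp
  have s: "sets \<mu> = sets borel" "sets \<nu> = sets borel"
    using assms by (auto simp: space_prob_algebra)
  show "countably_additive (sets borel)
      (\<lambda>A. ennreal t * emeasure \<mu> A + ennreal (1 - t) * emeasure \<nu> A)"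
    using s by (intro countably_additiveI)
      (simp add: suminf_add[symmetric] ennreal_suminf_cmult suminf_emeasure)
qed (use assms in \<open>auto simp: positive_def\<close>)

definition convex_on_probs :: "('a::topological_space measure \<Rightarrow> ereal) \<Rightarrow> bool" where
  "convex_on_probs \<alpha> \<longleftrightarrow>
     (\<forall>\<mu>\<in>probs. \<forall>\<nu>\<in>probs. \<forall>t\<in>{0..1}.
        \<alpha> (convex_comb t \<mu> \<nu>) \<le> ereal t * \<alpha> \<mu> + ereal (1 - t) * \<alpha> \<nu>)"

definition empirical_measure :: "nat \<Rightarrow> (nat \<Rightarrow> 'a::topological_space) \<Rightarrow> 'a measure" where
  "empirical_measure n x = measure_of UNIV (sets borel)
     (\<lambda>A. ennreal (1 / real n) * (\<Sum>i<n. emeasure (return borel (x i)) A))"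

lemma emeasure_empirical_measure:
  assumes "A \<in> sets borel"
  shows "emeasure (empirical_measure n x) A
    = ennreal (1 / real n) * (\<Sum>i<n. emeasure (return borel (x i)) A)"
  unfolding empirical_measure_def
proof (rule emeasure_measure_of_sigma)
  show "sigma_algebra UNIV (sets (borel :: 'a measure))"
    using sets.sigma_algebra_axioms[of "borel :: 'a measure"] by simp
  show "countably_additive (sets borel)
      (\<lambda>A. ennreal (1 / real n) * (\<Sum>i<n. emeasure (return borel (x i)) A))"
    by (intro countably_additiveI)
      (simp add: suminf_sum ennreal_suminf_cmult suminf_emeasure del: emeasure_return)
qed (use assms in \<open>auto simp: positive_def\<close>)

text \<open>The integral of an extended real function, as the difference of the integrals of
  its positive and negative parts (\<open>e2ennreal\<close> truncates at 0).\<close>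

definition ereal_integral :: "'b measure \<Rightarrow> ('b \<Rightarrow> ereal) \<Rightarrow> ereal" where
  "ereal_integral M f = enn2ereal (\<integral>\<^sup>+x. e2ennreal (f x) \<partial>M)
     - enn2ereal (\<integral>\<^sup>+x. e2ennreal (- f x) \<partial>M)"

text \<open>
  \<open>\<kappa> k\<close> is the conditional law of coordinate \<open>k\<close> given coordinates \<open>0, \<dots>, k - 1\<close>.
  The constant \<open>Ionescu_Tulcea.C \<kappa> (\<lambda>_. borel) 0 n (\<lambda>_. undefined)\<close> is the measure
  \<open>\<kappa> 0 (dx\<^sub>0) \<kappa> 1 (x\<^sub>0, dx\<^sub>1) \<dots>\<close> with \<open>n\<close> factors; \<open>\<lambda>_. undefined\<close> is the only point
  of the empty product. Kernels with index at least \<open>n\<close> are arbitrary and irrelevant.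
\<close>

definition disintegration ::
    "nat \<Rightarrow> (nat \<Rightarrow> 'a::topological_space) measure \<Rightarrow> (nat \<Rightarrow> (nat \<Rightarrow> 'a) \<Rightarrow> 'a measure) \<Rightarrow> bool" where
  "disintegration n \<nu> \<kappa> \<longleftrightarrow>
     (\<forall>k. \<kappa> k \<in> power_space k \<rightarrow>\<^sub>M prob_algebra borel) \<and>
     \<nu> = Ionescu_Tulcea.C \<kappa> (\<lambda>_. borel) 0 n (\<lambda>_. undefined)"

text \<open>A disintegration is unique only up to null sets; the value of \<open>alpha_n\<close> does not
  depend on the version that is chosen.\<close>

definition alpha_n ::
    "('a::topological_space measure \<Rightarrow> ereal) \<Rightarrow> nat \<Rightarrow> (nat \<Rightarrow> 'a) measure \<Rightarrow> ereal" where
  "alpha_n \<alpha> n \<nu> = (let \<kappa> = (SOME \<kappa>. disintegration n \<nu> \<kappa>) in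
     ereal_integral \<nu> (\<lambda>x. \<Sum>k<n. \<alpha> (\<kappa> k (restrict x {0..<k}))))"

definition rho_n ::
    "('a::topological_space measure \<Rightarrow> ereal) \<Rightarrow> nat \<Rightarrow> ((nat \<Rightarrow> 'a) \<Rightarrow> real) \<Rightarrow> ereal" where
  "rho_n \<alpha> n f = (SUP \<nu>\<in>space (prob_algebra (power_space n)).
     ereal (\<integral>x. f x \<partial>\<nu>) - alpha_n \<alpha> n \<nu>)"

lemma disintegration_Ionescu_Tulcea:
  assumes "disintegration n \<nu> \<kappa>"
  shows "Ionescu_Tulcea \<kappa> (\<lambda>_. borel)"
proof (rule Ionescu_Tulcea.intro)
  fix i
  have k: "\<kappa> i \<in> power_space i \<rightarrow>\<^sub>M prob_algebra borel"
    using assms by (simp add: disintegration_def)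
  then show "\<kappa> i \<in> power_space i \<rightarrow>\<^sub>M subprob_algebra borel"
    by (rule measurable_prob_algebraD)
  show "prob_space (\<kappa> i x)" if "x \<in> space (power_space i)" for x :: "nat \<Rightarrow> 'a"
    using measurable_space[OF k that] by (simp add: space_prob_algebra)
qed

end

theory Submission
  imports Defs
begin

text \<open>
  Let \<open>\<nu>\<close> be a law on \<open>E\<^sup>n\<close> with conditional laws \<open>\<kappa> k\<close>, and let \<open>A\<^sub>n(x)\<close> be the mean
  of \<open>\<kappa> 0, \<dots>, \<kappa> (n - 1)\<close> along the path \<open>x\<close>. For a bounded test function \<open>f\<close>, the number
  \<open>n (\<integral> f dL\<^sub>n - \<integral> f dA\<^sub>n)\<close> is a sum of \<open>n\<close> martingale differences
  \<open>f(x\<^sub>k) - \<integral> f d\<kappa> k\<close>, so its second moment is at most \<open>4 n (sup |f|)\<^sup>2\<close>, uniformly in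
  \<open>\<nu>\<close>. Hence \<open>L\<^sub>n\<close> and \<open>A\<^sub>n\<close> are indistinguishable, up to probability \<open>O(1/n)\<close>, by
  finitely many test functions (\<open>measure_deviation_set_le\<close>). Near a compact set of
  measures, finitely many test functions control the variation of \<open>F\<close>
  (\<open>weak_uniform_continuity_near_compact\<close>), so that \<open>F(L\<^sub>n)\<close> may be replaced by
  \<open>F(A\<^sub>n)\<close> whenever \<open>A\<^sub>n\<close> lies in that set.

  Upper bound. Convexity gives \<open>n \<alpha>(A\<^sub>n) \<le> \<Sum> \<alpha>(\<kappa> k)\<close>. Let \<open>s = sup (F - \<alpha>)\<close> be finite
  and \<open>|F| \<le> B\<close>. Where \<open>\<alpha>(A\<^sub>n) > B - s\<close>, the inequality \<open>F(L\<^sub>n) - \<alpha>(A\<^sub>n) < s\<close> is trivial.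
  Where \<open>\<alpha>(A\<^sub>n) \<le> B - s\<close>, the mean \<open>A\<^sub>n\<close> lies in a fixed compact sublevel set, and
  \<open>F(L\<^sub>n) - \<alpha>(A\<^sub>n) \<le> F(A\<^sub>n) - \<alpha>(A\<^sub>n) + \<epsilon> \<le> s + \<epsilon>\<close> outside an event of probability
  \<open>O(1/n)\<close>. Integrating bounds \<open>\<rho>\<^sub>n(n F \<circ> L\<^sub>n) / n\<close> by \<open>s + \<epsilon> + O(1/n)\<close>.

  Lower bound. For the product law of \<open>\<mu>\<close>, the value of \<open>\<alpha>\<^sub>n\<close> is \<open>n \<alpha>(\<mu>)\<close>, and the same
  estimate with the compact set \<open>{\<mu>}\<close> shows that the mean of \<open>F(L\<^sub>n)\<close> is at least
  \<open>F(\<mu>) - \<epsilon> - O(1/n)\<close>.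

  Since \<open>\<alpha>\<^sub>n\<close> is defined from some disintegration, the upper bound also requires that
  every law on \<open>E\<^sup>n\<close> has one (\<open>disintegration_exists\<close>), and the lower bound requires almost
  sure uniqueness (\<open>disintegration_unique_AE\<close>). Existence reduces to regular conditional
  distributions: a Polish space is a measurable retract of the real line, and on the line
  the conditional law is the image of the uniform law under a conditional quantile
  function.
\<close>

section \<open>Weak topology near compact sets\<close>

text \<open>
  The sets described by finitely many test functions and one radius form a neighbourhood
  base: this holds for the generating sets and survives finite intersections and unions.
\<close>

lemma weak_topology_neighbourhood:
  fixes \<mu> :: "'a::topological_space measure"
  assumes "openin weak_topology U" "\<mu> \<in> U"
  obtains J :: "('a \<Rightarrow> real) set" and \<delta> where
    "finite J" "\<And>f. f \<in> J \<Longrightarrow> continuous_on UNIV f \<and> bounded (range f)" "\<delta> > 0"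
    "\<And>\<eta>. \<eta> \<in> probs \<Longrightarrow> (\<And>f. f \<in> J \<Longrightarrow> \<bar>(\<integral>x. f x \<partial>\<mu>) - (\<integral>x. f x \<partial>\<eta>)\<bar> < \<delta>) \<Longrightarrow> \<eta> \<in> U"
proof -
  define Gen :: "'a measure set set" where
    "Gen = {{\<mu> \<in> probs. (\<integral>x. f x \<partial>\<mu>) \<in> U} | (f :: 'a \<Rightarrow> real) U.
        continuous_on UNIV f \<and> bounded (range f) \<and> open U}"
  have "generate_topology_on Gen U"
    using assms(1) unfolding weak_topology_def Gen_def by (rule openin_topology_generated_by)
  then have "\<mu> \<in> U \<longrightarrow> (\<exists>J :: ('a \<Rightarrow> real) set. \<exists>\<delta>>0. finite J \<and>
      (\<forall>f\<in>J. continuous_on UNIV f \<and> bounded (range f)) \<and>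
      (\<forall>\<eta>\<in>probs. (\<forall>f\<in>J. \<bar>(\<integral>x. f x \<partial>\<mu>) - (\<integral>x. f x \<partial>\<eta>)\<bar> < \<delta>) \<longrightarrow> \<eta> \<in> U))"
  proof (induction rule: generate_topology_on.induct)
    case Empty
    then show ?case by simp
  next
    case (Int a b)
    show ?case
    proof
      assume "\<mu> \<in> a \<inter> b"
      with Int obtain J1 J2 :: "('a \<Rightarrow> real) set" and d1 d2 :: real where
        1: "d1 > 0" "finite J1" "\<forall>f\<in>J1. continuous_on UNIV f \<and> bounded (range f)"
          "\<forall>\<eta>\<in>probs. (\<forall>f\<in>J1. \<bar>(\<integral>x. f x \<partial>\<mu>) - (\<integral>x. f x \<partial>\<eta>)\<bar> < d1) \<longrightarrow> \<eta> \<in> a"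
        and 2: "d2 > 0" "finite J2" "\<forall>f\<in>J2. continuous_on UNIV f \<and> bounded (range f)"
          "\<forall>\<eta>\<in>probs. (\<forall>f\<in>J2. \<bar>(\<integral>x. f x \<partial>\<mu>) - (\<integral>x. f x \<partial>\<eta>)\<bar> < d2) \<longrightarrow> \<eta> \<in> b"
        by auto
      show "\<exists>J :: ('a \<Rightarrow> real) set. \<exists>\<delta>>0. finite J \<and>
          (\<forall>f\<in>J. continuous_on UNIV f \<and> bounded (range f)) \<and>
          (\<forall>\<eta>\<in>probs. (\<forall>f\<in>J. \<bar>(\<integral>x. f x \<partial>\<mu>) - (\<integral>x. f x \<partial>\<eta>)\<bar> < \<delta>) \<longrightarrow> \<eta> \<in> a \<inter> b)"
        using 1 2 by (intro exI[of _ "J1 \<union> J2"] exI[of _ "min d1 d2"]) auto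
    qed
  next
    case (UN K)
    show ?case
    proof
      assume "\<mu> \<in> \<Union>K"
      then obtain k where k: "k \<in> K" "\<mu> \<in> k" by auto
      from UN.IH[OF k(1)] k obtain J :: "('a \<Rightarrow> real) set" and d :: real where
        "d > 0" "finite J" "\<forall>f\<in>J. continuous_on UNIV f \<and> bounded (range f)"
        "\<forall>\<eta>\<in>probs. (\<forall>f\<in>J. \<bar>(\<integral>x. f x \<partial>\<mu>) - (\<integral>x. f x \<partial>\<eta>)\<bar> < d) \<longrightarrow> \<eta> \<in> k"
        by auto
      with k show "\<exists>J :: ('a \<Rightarrow> real) set. \<exists>\<delta>>0. finite J \<and>
          (\<forall>f\<in>J. continuous_on UNIV f \<and> bounded (range f)) \<and>
          (\<forall>\<eta>\<in>probs. (\<forall>f\<in>J. \<bar>(\<integral>x. f x \<partial>\<mu>) - (\<integral>x. f x \<partial>\<eta>)\<bar> < \<delta>) \<longrightarrow> \<eta> \<in> \<Union>K)"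
        by (intro exI[of _ J] exI[of _ d]) blast
    qed
  next
    case (Basis s)
    show ?case
    proof
      assume m: "\<mu> \<in> s"
      from Basis obtain f :: "'a \<Rightarrow> real" and V where
        f: "continuous_on UNIV f" "bounded (range f)" and V: "open V"
        and s: "s = {\<mu> \<in> probs. (\<integral>x. f x \<partial>\<mu>) \<in> V}"
        unfolding Gen_def by auto
      from V m s obtain d where "d > 0" "ball (\<integral>x. f x \<partial>\<mu>) d \<subseteq> V"
        by (auto simp: open_contains_ball)
      then show "\<exists>J :: ('a \<Rightarrow> real) set. \<exists>\<delta>>0. finite J \<and>
          (\<forall>f\<in>J. continuous_on UNIV f \<and> bounded (range f)) \<and>
          (\<forall>\<eta>\<in>probs. (\<forall>f\<in>J. \<bar>(\<integral>x. f x \<partial>\<mu>) - (\<integral>x. f x \<partial>\<eta>)\<bar> < \<delta>) \<longrightarrow> \<eta> \<in> s)"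
        using f s by (intro exI[of _ "{f}"] exI[of _ d]) (auto simp: dist_real_def subset_iff)
    qed
  qed
  with assms(2) obtain J :: "('a \<Rightarrow> real) set" and \<delta> where "\<delta> > 0" "finite J"
      "\<forall>f\<in>J. continuous_on UNIV f \<and> bounded (range f)"
      "\<forall>\<eta>\<in>probs. (\<forall>f\<in>J. \<bar>(\<integral>x. f x \<partial>\<mu>) - (\<integral>x. f x \<partial>\<eta>)\<bar> < \<delta>) \<longrightarrow> \<eta> \<in> U"
    by auto
  then show ?thesis by (intro that) auto
qed

lemma openin_weak_topology_near:
  fixes \<mu> :: "'a::topological_space measure" and J :: "('a \<Rightarrow> real) set"
  assumes "finite J" "\<And>f. f \<in> J \<Longrightarrow> continuous_on UNIV f \<and> bounded (range f)"
  shows "openin weak_topology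
    {\<eta> \<in> probs. \<forall>f\<in>J. \<bar>(\<integral>x. f x \<partial>\<mu>) - (\<integral>x. f x \<partial>\<eta>)\<bar> < \<delta>}"
proof -
  have "openin weak_topology {\<eta> \<in> probs. \<bar>(\<integral>x. f x \<partial>\<mu>) - (\<integral>x. f x \<partial>\<eta>)\<bar> < \<delta>}" if "f \<in> J" for f
  proof -
    have "{\<eta> \<in> probs. \<bar>(\<integral>x. f x \<partial>\<mu>) - (\<integral>x. f x \<partial>\<eta>)\<bar> < \<delta>}
        = {\<eta> \<in> probs. (\<integral>x. f x \<partial>\<eta>) \<in> ball (\<integral>x. f x \<partial>\<mu>) \<delta>}"
      by (simp add: dist_real_def)
    moreover have "openin weak_topology \<dots>"
      unfolding weak_topology_def
      using assms(2)[OF that] by (intro topology_generated_by_Basis) blast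
    ultimately show ?thesis by simp
  qed
  then have "openin weak_topology (topspace weak_topology \<inter>
      (\<Inter>f\<in>J. {\<eta> \<in> probs. \<bar>(\<integral>x. f x \<partial>\<mu>) - (\<integral>x. f x \<partial>\<eta>)\<bar> < \<delta>}))"
    using assms(1) openin_topspace[of weak_topology] by (intro openin_Int_Inter) auto
  moreover have "topspace weak_topology \<inter>
      (\<Inter>f\<in>J. {\<eta> \<in> probs. \<bar>(\<integral>x. f x \<partial>\<mu>) - (\<integral>x. f x \<partial>\<eta>)\<bar> < \<delta>})
      = {\<eta> \<in> probs. \<forall>f\<in>J. \<bar>(\<integral>x. f x \<partial>\<mu>) - (\<integral>x. f x \<partial>\<eta>)\<bar> < \<delta>}"
    by auto
  ultimately show ?thesis by simp
qed

text \<open>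
  The Lebesgue number argument. Each point of \<open>K\<close> has a basic neighbourhood on which \<open>F\<close>
  varies by less than \<open>\<epsilon> / 2\<close>; the neighbourhoods with half the radius have a finite
  subcover, and the test functions and the least radius of that subcover serve all of \<open>K\<close>.
  The second measure ranges over all probability measures because empirical measures may
  lie outside \<open>K\<close>.
\<close>

lemma weak_uniform_continuity_near_compact:
  fixes F :: "'a::topological_space measure \<Rightarrow> real"
  assumes F: "continuous_map weak_topology euclideanreal F"
    and K: "compactin weak_topology K" and e: "\<epsilon> > 0"
  obtains J :: "('a \<Rightarrow> real) set" and \<delta> where
    "finite J" "\<And>f. f \<in> J \<Longrightarrow> continuous_on UNIV f \<and> bounded (range f)" "\<delta> > 0"
    "\<And>\<mu> \<eta>. \<mu> \<in> K \<Longrightarrow> \<eta> \<in> probs \<Longrightarrow>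
      (\<And>f. f \<in> J \<Longrightarrow> \<bar>(\<integral>x. f x \<partial>\<mu>) - (\<integral>x. f x \<partial>\<eta>)\<bar> < \<delta>) \<Longrightarrow> \<bar>F \<mu> - F \<eta>\<bar> < \<epsilon>"
proof -
  have Kp: "K \<subseteq> probs" using compactin_subset_topspace[OF K] by simp
  define good :: "'a measure \<Rightarrow> ('a \<Rightarrow> real) set \<times> real \<Rightarrow> bool" where
    "good \<mu> p \<longleftrightarrow> snd p > 0 \<and> finite (fst p) \<and> (\<forall>f\<in>fst p. continuous_on UNIV f \<and> bounded (range f)) \<and>
      (\<forall>\<eta>\<in>probs. (\<forall>f\<in>fst p. \<bar>(\<integral>x. f x \<partial>\<mu>) - (\<integral>x. f x \<partial>\<eta>)\<bar> < 2 * snd p) \<longrightarrow> \<bar>F \<mu> - F \<eta>\<bar> < \<epsilon> / 2)" for \<mu> p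
  have "\<exists>p. good \<mu> p" if "\<mu> \<in> K" for \<mu>
  proof -
    let ?U = "{\<eta> \<in> topspace weak_topology. F \<eta> \<in> ball (F \<mu>) (\<epsilon> / 2)}"
    have "openin weak_topology ?U"
      using F by (rule openin_continuous_map_preimage) simp
    moreover have "\<mu> \<in> ?U" using that Kp e by auto
    ultimately obtain J :: "('a \<Rightarrow> real) set" and d where J: "finite J"
        "\<And>f. f \<in> J \<Longrightarrow> continuous_on UNIV f \<and> bounded (range f)" "d > 0"
        "\<And>\<eta>. \<eta> \<in> probs \<Longrightarrow> (\<And>f. f \<in> J \<Longrightarrow> \<bar>(\<integral>x. f x \<partial>\<mu>) - (\<integral>x. f x \<partial>\<eta>)\<bar> < d) \<Longrightarrow> \<eta> \<in> ?U"
      by (rule weak_topology_neighbourhood) blast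
    have "good \<mu> (J, d / 2)"
      unfolding good_def using J(1-3) J(4) by (auto simp: dist_real_def)
    then show ?thesis ..
  qed
  then obtain p where p: "\<And>\<mu>. \<mu> \<in> K \<Longrightarrow> good \<mu> (p \<mu>)" by metis
  define V where "V \<mu> = {\<eta> \<in> probs. \<forall>f\<in>fst (p \<mu>). \<bar>(\<integral>x. f x \<partial>\<mu>) - (\<integral>x. f x \<partial>\<eta>)\<bar> < snd (p \<mu>)}" for \<mu>
  have "\<exists>\<F>. finite \<F> \<and> \<F> \<subseteq> V ` K \<and> K \<subseteq> \<Union>\<F>"
  proof (rule compactinD[OF K])
    show "openin weak_topology U" if "U \<in> V ` K" for U
      using that p unfolding V_def good_def
      by (auto intro!: openin_weak_topology_near)
    show "K \<subseteq> \<Union>(V ` K)"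
      using p Kp unfolding V_def good_def by force
  qed
  then obtain T where T: "finite T" "T \<subseteq> K" "K \<subseteq> \<Union>(V ` T)"
    by (metis (no_types, lifting) finite_subset_image)
  define J where "J = (\<Union>\<mu>\<in>T. fst (p \<mu>))"
  define \<delta> where "\<delta> = Min (insert 1 ((\<lambda>\<mu>. snd (p \<mu>)) ` T))"
  show ?thesis
  proof (rule that)
    show "finite J" unfolding J_def using T p good_def by auto
    show "continuous_on UNIV f \<and> bounded (range f)" if "f \<in> J" for f
      using that T p unfolding J_def good_def by blast
    show "\<delta> > 0" unfolding \<delta>_def using T p good_def by auto
    fix \<mu> \<eta> :: "'a measure"
    assume m: "\<mu> \<in> K" and n: "\<eta> \<in> probs"
      and near: "\<And>f. f \<in> J \<Longrightarrow> \<bar>(\<integral>x. f x \<partial>\<mu>) - (\<integral>x. f x \<partial>\<eta>)\<bar> < \<delta>"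
    from m T obtain \<tau> where \<tau>: "\<tau> \<in> T" "\<mu> \<in> V \<tau>" by auto
    then have g: "good \<tau> (p \<tau>)" using p T by auto
    have "\<delta> \<le> snd (p \<tau>)" unfolding \<delta>_def using T \<tau> by auto
    then have f: "\<bar>(\<integral>x. f x \<partial>\<tau>) - (\<integral>x. f x \<partial>\<eta>)\<bar> < 2 * snd (p \<tau>)"
        "\<bar>(\<integral>x. f x \<partial>\<tau>) - (\<integral>x. f x \<partial>\<mu>)\<bar> < 2 * snd (p \<tau>)" if "f \<in> fst (p \<tau>)" for f
      using \<tau>(2) that near[of f] \<tau>(1) g unfolding V_def J_def good_def
      by (force, force)
    have "\<bar>F \<tau> - F \<eta>\<bar> < \<epsilon> / 2" "\<bar>F \<tau> - F \<mu>\<bar> < \<epsilon> / 2"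
      using g f n m Kp unfolding good_def by auto
    then show "\<bar>F \<mu> - F \<eta>\<bar> < \<epsilon>" by linarith
  qed
qed

section \<open>Convex combinations, means and empirical measures\<close>

lemma sets_convex_comb [simp]: "sets (convex_comb t \<mu> \<nu>) = sets borel"
  unfolding convex_comb_def by (simp add: sets.sigma_sets_eq[of borel, unfolded space_borel])

lemma space_convex_comb [simp]: "space (convex_comb t \<mu> \<nu>) = UNIV"
  unfolding convex_comb_def by simp

lemma convex_comb_in_probs:
  assumes "\<mu> \<in> probs" "\<nu> \<in> probs" "0 \<le> t" "t \<le> 1"
  shows "convex_comb t \<mu> \<nu> \<in> probs"
proof -
  have s: "space \<mu> = UNIV" "space \<nu> = UNIV"
    using assms(1,2) sets_eq_imp_space_eq[of \<mu> borel] sets_eq_imp_space_eq[of \<nu> borel]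
    by (simp_all add: space_prob_algebra)
  have "emeasure \<mu> UNIV = 1" "emeasure \<nu> UNIV = 1"
    using assms(1,2) prob_space.emeasure_space_1[of \<mu>] prob_space.emeasure_space_1[of \<nu>] s
    by (auto simp: space_prob_algebra)
  then have "emeasure (convex_comb t \<mu> \<nu>) (space (convex_comb t \<mu> \<nu>)) = 1"
    using assms by (simp add: emeasure_convex_comb ennreal_plus[symmetric] del: ennreal_plus)
  then show ?thesis by (auto simp: space_prob_algebra intro: prob_spaceI)
qed

lemma nn_integral_convex_comb:
  fixes f :: "'a::topological_space \<Rightarrow> ennreal"
  assumes m: "\<mu> \<in> probs" "\<nu> \<in> probs" and f: "f \<in> borel_measurable borel"
  shows "(\<integral>\<^sup>+x. f x \<partial>convex_comb t \<mu> \<nu>)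
    = ennreal t * (\<integral>\<^sup>+x. f x \<partial>\<mu>) + ennreal (1 - t) * (\<integral>\<^sup>+x. f x \<partial>\<nu>)"
proof -
  have [measurable_cong, simp]: "sets \<mu> = sets borel" "sets \<nu> = sets borel"
    using m by (auto simp: space_prob_algebra)
  have [simp]: "space \<mu> = UNIV" "space \<nu> = UNIV"
    using m sets_eq_imp_space_eq[of \<mu> borel] sets_eq_imp_space_eq[of \<nu> borel]
    by (simp_all add: space_prob_algebra)
  note [measurable_cong] = sets_convex_comb[of t \<mu> \<nu>]
  from f show ?thesis
  proof (induction rule: borel_measurable_induct)
    case (cong f g)
    then show ?case by (simp cong: nn_integral_cong)
  next
    case (set A)
    then show ?case using emeasure_convex_comb[OF m, of A] by simp
  next
    case (mult u c)
    then have [measurable]: "u \<in> borel_measurable borel" by simp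
    show ?case using mult by (simp add: nn_integral_cmult algebra_simps)
  next
    case (add u v)
    then have [measurable]: "u \<in> borel_measurable borel" "v \<in> borel_measurable borel" by simp_all
    show ?case using add by (simp add: nn_integral_add algebra_simps)
  next
    case (seq U)
    have [measurable]: "U i \<in> borel_measurable borel" for i using seq by simp
    have inc: "incseq (\<lambda>i. integral\<^sup>N M (U i))" for M :: "'a measure"
      using seq(3) by (auto simp: incseq_def le_fun_def intro!: nn_integral_mono)
    have sup: "(SUP i. U i) = (\<lambda>x. SUP i. U i x)"
      by (simp add: fun_eq_iff Sup_fun_def image_image)
    have "(\<integral>\<^sup>+x. (SUP i. U i) x \<partial>convex_comb t \<mu> \<nu>) = (SUP i. integral\<^sup>N (convex_comb t \<mu> \<nu>) (U i))"
      using seq(3) unfolding sup by (simp add: nn_integral_monotone_convergence_SUP)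
    also have "\<dots> = (SUP i. ennreal t * integral\<^sup>N \<mu> (U i) + ennreal (1 - t) * integral\<^sup>N \<nu> (U i))"
      using seq by simp
    also have "\<dots> = (SUP i. ennreal t * integral\<^sup>N \<mu> (U i)) + (SUP i. ennreal (1 - t) * integral\<^sup>N \<nu> (U i))"
      using inc by (intro ennreal_SUP_add) (auto simp: incseq_def intro!: mult_left_mono)
    also have "\<dots> = ennreal t * (\<integral>\<^sup>+x. (SUP i. U i) x \<partial>\<mu>) + ennreal (1 - t) * (\<integral>\<^sup>+x. (SUP i. U i) x \<partial>\<nu>)"
      using seq(3) unfolding sup by (simp add: nn_integral_monotone_convergence_SUP SUP_mult_left_ennreal)
    finally show ?case by simp
  qed
qed

lemma probs_integrable:
  fixes f :: "'a::topological_space \<Rightarrow> real"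
  assumes "\<mu> \<in> probs" "f \<in> borel_measurable borel" "bounded (range f)"
  shows "integrable \<mu> f"
proof -
  interpret prob_space \<mu> using assms(1) by (simp add: space_prob_algebra)
  have "sets \<mu> = sets borel" using assms(1) by (simp add: space_prob_algebra)
  with assms(2) have "f \<in> borel_measurable \<mu>" by (simp cong: measurable_cong_sets)
  moreover obtain B where "\<And>x. norm (f x) \<le> B" using assms(3) by (auto simp: bounded_iff)
  ultimately show ?thesis by (intro integrable_const_bound[of _ B]) auto
qed

lemma integral_convex_comb:
  fixes f :: "'a::topological_space \<Rightarrow> real"
  assumes m: "\<mu> \<in> probs" "\<nu> \<in> probs" and t: "0 \<le> t" "t \<le> 1"
    and f: "f \<in> borel_measurable borel" "bounded (range f)"
  shows "(\<integral>x. f x \<partial>convex_comb t \<mu> \<nu>) = t * (\<integral>x. f x \<partial>\<mu>) + (1 - t) * (\<integral>x. f x \<partial>\<nu>)"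
proof -
  note i = probs_integrable[OF m(1) f] probs_integrable[OF m(2) f]
    probs_integrable[OF convex_comb_in_probs[OF m t] f]
  have fin: "(\<integral>\<^sup>+x. ennreal (f x) \<partial>\<eta>) < top" "(\<integral>\<^sup>+x. ennreal (- f x) \<partial>\<eta>) < top"
    if "integrable \<eta> f" for \<eta>
    using real_integrable_def[of \<eta> f] that by (auto simp: top.not_eq_extremum)
  have *: "enn2real (ennreal t * a + ennreal (1 - t) * b) = t * enn2real a + (1 - t) * enn2real b"
    if "a < top" "b < top" for a b
    using that t by (subst enn2real_plus) (auto simp: ennreal_mult_less_top enn2real_mult)
  have "(\<integral>x. f x \<partial>convex_comb t \<mu> \<nu>)
    = enn2real (ennreal t * (\<integral>\<^sup>+x. ennreal (f x) \<partial>\<mu>) + ennreal (1 - t) * (\<integral>\<^sup>+x. ennreal (f x) \<partial>\<nu>))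
    - enn2real (ennreal t * (\<integral>\<^sup>+x. ennreal (- f x) \<partial>\<mu>) + ennreal (1 - t) * (\<integral>\<^sup>+x. ennreal (- f x) \<partial>\<nu>))"
    using f(1) by (simp add: real_lebesgue_integral_def[OF i(3)] nn_integral_convex_comb[OF m])
  also have "\<dots> = t * (\<integral>x. f x \<partial>\<mu>) + (1 - t) * (\<integral>x. f x \<partial>\<nu>)"
    using fin[OF i(1)] fin[OF i(2)]
    by (simp add: real_lebesgue_integral_def[OF i(1)] real_lebesgue_integral_def[OF i(2)] * algebra_simps)
  finally show ?thesis .
qed

text \<open>
  The arithmetic mean of the first \<open>n\<close> measures, built from binary convex combinations so
  that binary convexity of \<open>\<alpha>\<close> applies. The value at \<open>0\<close> is an arbitrary probability
  measure: it enters \<open>mean_measure m 1\<close> with weight \<open>0\<close>.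
\<close>

primrec mean_measure :: "(nat \<Rightarrow> 'a::topological_space measure) \<Rightarrow> nat \<Rightarrow> 'a measure" where
  "mean_measure m 0 = m 0"
| "mean_measure m (Suc n) = convex_comb (real n / real (Suc n)) (mean_measure m n) (m n)"

lemma mean_measure_in_probs:
  assumes "\<And>k. m k \<in> probs"
  shows "mean_measure m n \<in> probs"
  using assms by (induction n) (auto intro!: convex_comb_in_probs simp: field_simps)

lemma integral_mean_measure:
  fixes f :: "'a::topological_space \<Rightarrow> real"
  assumes m: "\<And>k. m k \<in> probs" and f: "f \<in> borel_measurable borel" "bounded (range f)"
  shows "real n * (\<integral>x. f x \<partial>mean_measure m n) = (\<Sum>k<n. \<integral>x. f x \<partial>m k)"
proof (induction n)
  case (Suc n)
  have "(\<integral>x. f x \<partial>mean_measure m (Suc n)) = real n / real (Suc n) * (\<integral>x. f x \<partial>mean_measure m n)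
      + (1 - real n / real (Suc n)) * (\<integral>x. f x \<partial>m n)"
    unfolding mean_measure.simps
    by (intro integral_convex_comb mean_measure_in_probs m f) (auto simp: field_simps)
  also have "1 - real n / real (Suc n) = 1 / real (Suc n)" by (simp add: field_simps)
  finally have "real (Suc n) * (\<integral>x. f x \<partial>mean_measure m (Suc n))
      = real n * (\<integral>x. f x \<partial>mean_measure m n) + (\<integral>x. f x \<partial>m n)"
    by (simp only: distrib_left) simp
  with Suc show ?case by simp
qed simp

text \<open>
  Jensen's inequality for the mean. Since \<open>ereal 0 * \<infinity> = 0\<close>, it also holds for \<open>n = 0\<close>
  and through the first step, where the weight of the previous mean vanishes.
\<close>

lemma convex_mean_measure:
  assumes conv: "convex_on_probs \<alpha>" and m: "\<And>k. m k \<in> probs"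
    and ninf: "\<And>\<nu>. \<nu> \<in> probs \<Longrightarrow> \<alpha> \<nu> \<noteq> -\<infinity>"
  shows "ereal (real n) * \<alpha> (mean_measure m n) \<le> (\<Sum>k<n. \<alpha> (m k))"
proof (induction n)
  case 0
  then show ?case by (simp add: zero_ereal_def[symmetric])
next
  case (Suc n)
  let ?t = "real n / real (Suc n)"
  have mm: "mean_measure m n \<in> probs" by (rule mean_measure_in_probs[OF m])
  have "\<alpha> (mean_measure m (Suc n)) \<le> ereal ?t * \<alpha> (mean_measure m n) + ereal (1 - ?t) * \<alpha> (m n)"
    using conv[unfolded convex_on_probs_def, rule_format, OF mm m, of ?t n] by (simp add: field_simps)
  then have "ereal (real (Suc n)) * \<alpha> (mean_measure m (Suc n))
      \<le> ereal (real (Suc n)) * (ereal ?t * \<alpha> (mean_measure m n) + ereal (1 - ?t) * \<alpha> (m n))"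
    by (intro ereal_mult_left_mono) auto
  also have "\<dots> = ereal (real n) * \<alpha> (mean_measure m n) + \<alpha> (m n)"
  proof (cases "n = 0")
    case True
    then show ?thesis by (simp add: zero_ereal_def[symmetric] one_ereal_def[symmetric])
  next
    case False
    have t: "1 - ?t = 1 / real (Suc n)" by (simp add: field_simps)
    have "real (Suc n) * (?t * a + 1 / real (Suc n) * b) = real n * a + b" for a b :: real
      by (simp only: distrib_left) simp
    with False show ?thesis
      using ninf[OF mm] ninf[OF m, of n] unfolding t
      by (cases "\<alpha> (mean_measure m n)"; cases "\<alpha> (m n)") (auto simp del: of_nat_Suc)
  qed
  also have "\<dots> \<le> (\<Sum>k<Suc n. \<alpha> (m k))"
    using Suc by (auto intro: add_right_mono)
  finally show ?case .
qed

text \<open>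
  This identification gives the integrals against empirical measures as a special case of
  those against means.
\<close>

lemma empirical_measure_eq_mean:
  assumes "n > 0"
  shows "empirical_measure n x = mean_measure (\<lambda>k. return borel (x k)) n"
proof (rule measure_eqI)
  have r: "return borel (x k) \<in> probs" for k
    by (auto simp: space_prob_algebra intro: prob_space_return)
  note mp = mean_measure_in_probs[of "\<lambda>k. return borel (x k)" n, OF r]
  show "sets (empirical_measure n x) = sets (mean_measure (\<lambda>k. return borel (x k)) n)"
    using mp by (simp add: empirical_measure_def sets.sigma_sets_eq[of borel, unfolded space_borel] space_prob_algebra)
  fix A assume "A \<in> sets (empirical_measure n x)"
  then have A: "A \<in> sets borel"
    by (simp add: empirical_measure_def sets.sigma_sets_eq[of borel, unfolded space_borel])
  interpret prob_space "mean_measure (\<lambda>k. return borel (x k)) n"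
    using mp by (simp add: space_prob_algebra)
  have "bounded (range (indicat_real A))"
    by (auto simp: bounded_iff indicator_def intro!: exI[of _ 1])
  from integral_mean_measure[of "\<lambda>k. return borel (x k)" "indicat_real A", OF r _ this, of n]
  have "real n * measure (mean_measure (\<lambda>k. return borel (x k)) n) A = (\<Sum>k<n. indicat_real A (x k))"
    using A mp by (simp add: measure_return space_prob_algebra)
  then have "measure (mean_measure (\<lambda>k. return borel (x k)) n) A = 1 / real n * (\<Sum>k<n. indicat_real A (x k))"
    using assms by (simp add: field_simps)
  moreover have "(\<Sum>k<n. indicator A (x k)) = ennreal (\<Sum>k<n. indicat_real A (x k))"
    by (subst sum_ennreal[symmetric]) (auto simp: ennreal_indicator)
  ultimately show "emeasure (empirical_measure n x) A = emeasure (mean_measure (\<lambda>k. return borel (x k)) n) A"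
    using A by (simp add: emeasure_empirical_measure emeasure_eq_measure ennreal_mult[symmetric] sum_nonneg)
qed

lemma empirical_measure_in_probs:
  assumes "n > 0"
  shows "empirical_measure n x \<in> probs"
  unfolding empirical_measure_eq_mean[OF assms]
  by (intro mean_measure_in_probs) (auto simp: space_prob_algebra intro: prob_space_return)

lemma integral_empirical_measure:
  fixes f :: "'a::topological_space \<Rightarrow> real"
  assumes "n > 0" and f: "f \<in> borel_measurable borel" "bounded (range f)"
  shows "(\<integral>y. f y \<partial>empirical_measure n x) = (\<Sum>k<n. f (x k)) / real n"
proof -
  have r: "return borel (x k) \<in> probs" for k
    by (auto simp: space_prob_algebra intro: prob_space_return)
  from integral_mean_measure[of "\<lambda>k. return borel (x k)", OF r f, of n]
  show ?thesis using assms by (simp add: empirical_measure_eq_mean integral_return field_simps)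
qed

lemma continuous_map_empirical_measure:
  assumes "n > 0"
  shows "continuous_map euclidean weak_topology
    (empirical_measure n :: (nat \<Rightarrow> 'a::topological_space) \<Rightarrow> 'a measure)"
  unfolding weak_topology_def
proof (rule continuous_on_generated_topo, goal_cases)
  case (1 U)
  then obtain f :: "'a \<Rightarrow> real" and V where f: "continuous_on UNIV f" "bounded (range f)" and V: "open V"
    and U: "U = {\<mu> \<in> probs. (\<integral>x. f x \<partial>\<mu>) \<in> V}" by auto
  have fm: "f \<in> borel_measurable borel" using f(1) by (rule borel_measurable_continuous_onI)
  have "continuous_on UNIV (\<lambda>x :: nat \<Rightarrow> 'a. (\<Sum>k<n. f (x k)) / real n)"
    using assms by (intro continuous_intros continuous_on_compose2[OF f(1)] continuous_on_product_coordinates) auto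
  then have "open ((\<lambda>x :: nat \<Rightarrow> 'a. (\<Sum>k<n. f (x k)) / real n) -` V)"
    using V by (simp add: continuous_on_open_vimage)
  moreover have "(\<lambda>x :: nat \<Rightarrow> 'a. (\<Sum>k<n. f (x k)) / real n) -` V = empirical_measure n -` U"
    using assms by (auto simp: U integral_empirical_measure[OF assms fm f(2)] empirical_measure_in_probs)
  ultimately show ?case by simp
next
  case 2
  have "\<Union> {{\<mu> \<in> probs. (\<integral>x. f x \<partial>\<mu>) \<in> U} |(f :: 'a \<Rightarrow> real) U.
      continuous_on UNIV f \<and> bounded (range f) \<and> open U} = topspace weak_topology"
    unfolding weak_topology_def topology_generated_by_topspace ..
  then show ?case using empirical_measure_in_probs[OF assms] by auto
qed

text \<open>
  \<open>F \<circ> L\<^sub>n\<close> is continuous on the countable power \<open>nat \<Rightarrow> E\<close>, whose Borel sets are the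
  product sets by second countability, and \<open>E\<^sup>n\<close> embeds there measurably because
  its points are constant beyond \<open>n\<close>.
\<close>

lemma borel_measurable_comp_empirical_measure:
  fixes F :: "'a::second_countable_topology measure \<Rightarrow> real"
  assumes F: "continuous_map weak_topology euclideanreal F" and n: "n > 0"
  shows "(\<lambda>x. F (empirical_measure n x)) \<in> borel_measurable (power_space n)"
proof -
  have "continuous_map euclidean euclideanreal (F \<circ> empirical_measure n)"
    using continuous_map_empirical_measure[OF n] F by (rule continuous_map_compose)
  then have "F \<circ> empirical_measure n \<in> borel_measurable borel"
    by (intro borel_measurable_continuous_onI) simp
  moreover have "(\<lambda>x. x) \<in> power_space n \<rightarrow>\<^sub>M (borel :: (nat \<Rightarrow> 'a) measure)"
  proof (rule measurable_coordinatewise_then_product)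
    fix i
    show "(\<lambda>x. x i) \<in> power_space n \<rightarrow>\<^sub>M (borel :: 'a measure)"
    proof (cases "i < n")
      case False
      then show ?thesis
        by (subst measurable_cong[where g = "\<lambda>_. undefined"]) (auto simp: space_PiM PiE_def extensional_def)
    qed (simp add: measurable_component_singleton)
  qed
  ultimately have "(F \<circ> empirical_measure n) \<circ> (\<lambda>x. x) \<in> borel_measurable (power_space n)"
    by (rule measurable_comp[rotated])
  then show ?thesis by (simp add: comp_def)
qed

section \<open>Regular conditional distributions in Polish spaces\<close>

text \<open>
  The Cantor map: the point of the ternary Cantor set with digits \<open>0\<close> and \<open>2\<close> given by \<open>b\<close>.
\<close>

definition cantor_code :: "(nat \<Rightarrow> bool) \<Rightarrow> real" where
  "cantor_code b = (\<Sum>j. (if b j then 2 / 3 else 0) * (1 / 3) ^ j)"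

text \<open>
  The shift by \<open>j\<close> ternary digits on the Cantor set, written as a Borel function of the
  whole line: the leading digit is \<open>2\<close> iff the number is at least \<open>1 / 2\<close>, since the middle
  third is avoided.
\<close>

primrec cantor_remainder :: "nat \<Rightarrow> real \<Rightarrow> real" where
  "cantor_remainder 0 z = z"
| "cantor_remainder (Suc j) z =
    3 * cantor_remainder j z - (if cantor_remainder j z \<ge> 1 / 2 then 2 else 0)"

lemma summable_cantor: "summable (\<lambda>j. (if b j then 2 / 3 else 0) * (1 / 3 :: real) ^ j)"
  by (rule summable_comparison_test'[of "\<lambda>j. (2 / 3) * (1 / 3 :: real) ^ j" 0]) (auto intro: summable_mult)

lemma cantor_code_bounds: "0 \<le> cantor_code b" "cantor_code b \<le> 1"
proof -
  show "0 \<le> cantor_code b"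
    unfolding cantor_code_def by (intro suminf_nonneg summable_cantor) auto
  have "cantor_code b \<le> (\<Sum>j. (2 / 3) * (1 / 3 :: real) ^ j)"
    unfolding cantor_code_def by (intro suminf_le summable_cantor summable_mult) auto
  also have "\<dots> = 1" by (subst suminf_mult) (auto simp: suminf_geometric)
  finally show "cantor_code b \<le> 1" .
qed

lemma cantor_code_shift:
  "cantor_code b = (if b 0 then 2 / 3 else 0) + cantor_code (\<lambda>i. b (Suc i)) / 3"
proof -
  have "cantor_code b - (if b 0 then 2 / 3 else 0)
      = (\<Sum>j. (if b (Suc j) then 2 / 3 else 0) * (1 / 3 :: real) ^ Suc j)"
    unfolding cantor_code_def using suminf_split_head[OF summable_cantor[of b]] by simp
  also have "\<dots> = (\<Sum>j. (if b (Suc j) then 2 / 3 else 0) * (1 / 3 :: real) ^ j / 3)"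
    by simp
  also have "\<dots> = cantor_code (\<lambda>i. b (Suc i)) / 3"
    unfolding cantor_code_def by (intro suminf_divide summable_cantor)
  finally show ?thesis by simp
qed

lemma cantor_digit: "1 / 2 \<le> cantor_code b \<longleftrightarrow> b 0"
  using cantor_code_shift[of b] cantor_code_bounds[of "\<lambda>i. b (Suc i)"] by auto

lemma cantor_remainder_code: "cantor_remainder j (cantor_code b) = cantor_code (\<lambda>i. b (i + j))"
proof (induction j)
  case (Suc j)
  show ?case
    using cantor_code_shift[of "\<lambda>i. b (i + j)"] cantor_digit[of "\<lambda>i. b (i + j)"]
    by (simp add: Suc)
qed simp

text \<open>
  A point \<open>y\<close> is encoded by the bits \<open>dist y (d i) < 2\<^sup>-\<^sup>m\<close> for a dense sequence \<open>d\<close>. Decoding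
  takes, for each \<open>m\<close>, the first \<open>i\<close> whose bit is set; these points converge to \<open>y\<close>. Where
  they fail to converge, outside the codes, a constant sequence is substituted.
  With a left inverse on the whole line, any kernel of laws on the line can be pushed
  forward to the Polish space, even one that charges points outside the range of \<open>h\<close>.
\<close>

lemma polish_retract_of_real:
  obtains h :: "'a::polish_space \<Rightarrow> real" and g :: "real \<Rightarrow> 'a" where
    "h \<in> borel_measurable borel" "g \<in> borel_measurable borel"
    "\<And>y. g (h y) = y" "\<And>y. 0 \<le> h y \<and> h y \<le> 1"
proof -
  obtain D :: "'a set" where D: "countable D" "\<And>X. open X \<Longrightarrow> X \<noteq> {} \<Longrightarrow> \<exists>d\<in>D. d \<in> X"
    using countable_dense_exists by blast
  define d where "d = from_nat_into D"
  have "D \<noteq> {}" using D(2)[of UNIV] by auto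
  have dense: "\<exists>i. dist y (d i) < \<epsilon>" if "\<epsilon> > 0" for y \<epsilon>
  proof -
    from D(2)[of "ball y \<epsilon>"] that obtain x where "x \<in> D" "dist y x < \<epsilon>" by auto
    then show ?thesis using from_nat_into_surj[OF D(1)] unfolding d_def by metis
  qed
  define bit where "bit y n = (case prod_decode n of (m, i) \<Rightarrow> dist y (d i) < (1 / 2) ^ m)" for y n
  define h where "h y = cantor_code (bit y)" for y
  define c where "c m z = (LEAST i. cantor_remainder (prod_encode (m, i)) z \<ge> 1 / 2)" for m z
  define u where "u m z = d (c m z)" for m z
  define g where "g z = lim (\<lambda>m. if Cauchy (\<lambda>m. u m z) then u m z else d 0)" for z
  have [measurable]: "cantor_remainder j \<in> borel_measurable borel" for j
    by (induction j) simp_all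
  have [measurable]: "c m \<in> borel \<rightarrow>\<^sub>M count_space UNIV" for m
    unfolding c_def by measurable
  have [measurable]: "u m \<in> borel_measurable borel" for m
    unfolding u_def by (rule measurable_compose[of "c m" _ "count_space UNIV"]) auto
  show ?thesis
  proof (rule that)
    have "(\<lambda>y. bit y n) \<in> borel \<rightarrow>\<^sub>M count_space UNIV" for n
      unfolding bit_def by (cases "prod_decode n") simp
    then show "h \<in> borel_measurable borel"
      unfolding h_def cantor_code_def by measurable
    show "g \<in> borel_measurable borel"
    proof (rule borel_measurable_LIMSEQ_metric)
      fix z
      have "convergent (\<lambda>m. if Cauchy (\<lambda>m. u m z) then u m z else d 0)"
        by (cases "Cauchy (\<lambda>m. u m z)") (auto simp: convergent_const Cauchy_convergent)
      then show "(\<lambda>m. if Cauchy (\<lambda>m. u m z) then u m z else d 0) \<longlonglongrightarrow> g z"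
        unfolding g_def by (rule convergent_LIMSEQ_iff[THEN iffD1])
    qed measurable
    fix y
    show "0 \<le> h y \<and> h y \<le> 1" unfolding h_def using cantor_code_bounds by auto
    have "dist y (u m (h y)) < (1 / 2) ^ m" for m
    proof -
      have "1 / 2 \<le> cantor_remainder (prod_encode (m, i)) (h y) \<longleftrightarrow> dist y (d i) < (1 / 2) ^ m" for i
        unfolding h_def cantor_remainder_code cantor_digit by (simp add: bit_def)
      then show ?thesis
        unfolding u_def c_def using LeastI_ex[OF dense[of "(1 / 2) ^ m" y]] by simp
    qed
    then have "(\<lambda>m. dist (u m (h y)) y) \<longlonglongrightarrow> 0"
      by (intro tendsto_sandwich[OF _ _ tendsto_const LIMSEQ_power_zero[of "1 / 2 :: real"]])
        (auto simp: dist_commute less_imp_le intro!: always_eventually)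
    then have l: "(\<lambda>m. u m (h y)) \<longlonglongrightarrow> y" by (rule tendsto_dist_iff[THEN iffD2])
    then show "g (h y) = y"
      unfolding g_def using LIMSEQ_imp_Cauchy[OF l] by (simp add: limI)
  qed
qed

lemma AE_le_if_nn_integral_le:
  fixes f g :: "'b \<Rightarrow> ennreal"
  assumes [measurable]: "f \<in> borel_measurable M" "g \<in> borel_measurable M"
    and fin: "(\<integral>\<^sup>+x. f x \<partial>M) < \<infinity>"
    and le: "\<And>B. B \<in> sets M \<Longrightarrow> (\<integral>\<^sup>+x. f x * indicator B x \<partial>M) \<le> (\<integral>\<^sup>+x. g x * indicator B x \<partial>M)"
  shows "AE x in M. f x \<le> g x"
proof -
  define B where "B = {x \<in> space M. g x < f x}"
  have B[measurable]: "B \<in> sets M" unfolding B_def by measurable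
  have "(\<integral>\<^sup>+x. g x * indicator B x \<partial>M) \<le> (\<integral>\<^sup>+x. f x \<partial>M)"
    by (intro nn_integral_mono) (auto simp: B_def indicator_def)
  then have "(\<integral>\<^sup>+x. f x * indicator B x - g x * indicator B x \<partial>M)
      = (\<integral>\<^sup>+x. f x * indicator B x \<partial>M) - (\<integral>\<^sup>+x. g x * indicator B x \<partial>M)"
    using fin by (intro nn_integral_diff) (auto simp: B_def indicator_def)
  also have "\<dots> = 0"
  proof (rule diff_eq_0_ennreal[OF _ le[OF B]])
    have "(\<integral>\<^sup>+x. f x * indicator B x \<partial>M) \<le> (\<integral>\<^sup>+x. f x \<partial>M)"
      by (intro nn_integral_mono) (auto simp: indicator_def)
    with fin show "(\<integral>\<^sup>+x. f x * indicator B x \<partial>M) < top" by simp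
  qed
  finally have "AE x in M. f x * indicator B x - g x * indicator B x = 0"
    by (subst (asm) nn_integral_0_iff_AE) auto
  with AE_space show ?thesis
  proof eventually_elim
    case (elim x)
    show ?case
    proof (rule ccontr)
      assume "\<not> f x \<le> g x"
      then have "g x < f x" by simp
      then show False using elim
        by (auto simp add: B_def indicator_def diff_eq_0_iff_ennreal)
    qed
  qed
qed

text \<open>
  For rational \<open>q\<close>, let \<open>F q\<close> be a version of the conditional probability of \<open>Z \<le> q\<close> given
  \<open>X\<close>. The function \<open>W x\<close> is the corresponding quantile function, restricted to rational
  levels, so that for \<open>t \<le> 1\<close>, \<open>W x u < t\<close> iff \<open>u \<le> F q x\<close> for some rational \<open>q < t\<close>. For almost every
  \<open>x\<close> the values \<open>F q x\<close> increase in \<open>q\<close> and are at most \<open>1\<close>, and the uniform measure of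
  this event is the supremum of \<open>F q x\<close> over \<open>q < t\<close>. Taking the infimum with values in
  \<open>{0..1}\<close> makes \<open>W x\<close> a real function for every \<open>x\<close>, including the exceptional null set
  where \<open>F q x\<close> is not a distribution function of \<open>q\<close>.
\<close>

lemma regular_conditional_distribution_real:
  fixes N :: "'c measure" and M :: "'b measure" and Z :: "'c \<Rightarrow> real"
  assumes N: "prob_space N" and X[measurable]: "X \<in> N \<rightarrow>\<^sub>M M" and Z[measurable]: "Z \<in> borel_measurable N"
    and Z01: "\<And>\<omega>. \<omega> \<in> space N \<Longrightarrow> 0 \<le> Z \<omega> \<and> Z \<omega> \<le> 1"
  obtains W :: "'b \<Rightarrow> real \<Rightarrow> real" where
    "(\<lambda>(x, u). W x u) \<in> M \<Otimes>\<^sub>M borel \<rightarrow>\<^sub>M borel"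
    "\<And>B t. B \<in> sets M \<Longrightarrow> emeasure N {\<omega> \<in> space N. X \<omega> \<in> B \<and> Z \<omega> < t}
      = (\<integral>\<^sup>+x. emeasure (uniform_measure lborel {0..1}) {u. W x u < t} * indicator B x \<partial>distr N M X)"
proof -
  interpret N: prob_space N by fact
  define \<mu> where "\<mu> = distr N M X"
  interpret \<mu>: prob_space \<mu> unfolding \<mu>_def by (rule N.prob_space_distr) measurable
  have [measurable_cong, simp]: "sets \<mu> = sets M" and [simp]: "space \<mu> = space M"
    by (simp_all add: \<mu>_def)
  define \<nu> where "\<nu> q = distr (density N (indicator {\<omega> \<in> space N. Z \<omega> \<le> q})) M X" for q
  have \<nu>: "emeasure (\<nu> q) B = emeasure N {\<omega> \<in> space N. X \<omega> \<in> B \<and> Z \<omega> \<le> q}" if [measurable]: "B \<in> sets M" for q B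
  proof -
    have "emeasure (\<nu> q) B = (\<integral>\<^sup>+\<omega>. indicator {\<omega> \<in> space N. Z \<omega> \<le> q} \<omega> * indicator (X -` B \<inter> space N) \<omega> \<partial>N)"
      unfolding \<nu>_def by (simp add: emeasure_distr emeasure_density)
    also have "\<dots> = (\<integral>\<^sup>+\<omega>. indicator {\<omega> \<in> space N. X \<omega> \<in> B \<and> Z \<omega> \<le> q} \<omega> \<partial>N)"
      by (intro nn_integral_cong) (auto simp: indicator_def)
    also have "\<dots> = emeasure N {\<omega> \<in> space N. X \<omega> \<in> B \<and> Z \<omega> \<le> q}" by simp
    finally show ?thesis .
  qed
  have [simp, measurable_cong]: "sets (\<nu> q) = sets M" for q by (simp add: \<nu>_def)
  have \<mu>e: "emeasure \<mu> B = emeasure N {\<omega> \<in> space N. X \<omega> \<in> B}" if "B \<in> sets M" for B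
    unfolding \<mu>_def using that by (simp add: emeasure_distr vimage_def Int_def conj_commute)
  define F where "F q = RN_deriv \<mu> (\<nu> q)" for q
  have [measurable]: "F q \<in> borel_measurable M" for q
    using borel_measurable_RN_deriv[of \<mu> "\<nu> q"] by (simp add: F_def cong: measurable_cong_sets)
  have "absolutely_continuous \<mu> (\<nu> q)" for q
  proof -
    have "emeasure (\<nu> q) B \<le> emeasure \<mu> B" if "B \<in> sets M" for B
      unfolding \<nu>[OF that] \<mu>e[OF that] using that by (intro emeasure_mono) auto
    then have "emeasure (\<nu> q) B = 0" if "B \<in> sets M" "emeasure \<mu> B = 0" for B
      using that by (metis le_zero_eq)
    then show ?thesis unfolding absolutely_continuous_def null_sets_def by auto
  qed
  then have dens: "density \<mu> (F q) = \<nu> q" for q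
    unfolding F_def by (intro \<mu>.density_RN_deriv) auto
  have F: "(\<integral>\<^sup>+x. F q x * indicator B x \<partial>\<mu>) = emeasure N {\<omega> \<in> space N. X \<omega> \<in> B \<and> Z \<omega> \<le> q}"
    if [measurable]: "B \<in> sets M" for q B
    using arg_cong[OF dens[of q], of "\<lambda>m. emeasure m B"] by (simp add: emeasure_density \<nu>)
  have Ffin: "(\<integral>\<^sup>+x. F q x \<partial>\<mu>) < \<infinity>" for q
  proof -
    have "(\<integral>\<^sup>+x. F q x \<partial>\<mu>) = (\<integral>\<^sup>+x. F q x * indicator (space M) x \<partial>\<mu>)"
      by (intro nn_integral_cong) auto
    then show ?thesis using F[of "space M" q] by (simp add: N.emeasure_eq_measure)
  qed
  have mono: "AE x in \<mu>. F q x \<le> F q' x" if "q \<le> q'" for q q'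
  proof (rule AE_le_if_nn_integral_le[OF _ _ Ffin])
    fix B assume "B \<in> sets \<mu>"
    then show "(\<integral>\<^sup>+x. F q x * indicator B x \<partial>\<mu>) \<le> (\<integral>\<^sup>+x. F q' x * indicator B x \<partial>\<mu>)"
      using that by (simp add: F) (intro emeasure_mono, auto)
  qed auto
  have le1: "AE x in \<mu>. F q x \<le> 1" for q
  proof (rule AE_le_if_nn_integral_le[OF _ _ Ffin])
    fix B assume B: "B \<in> sets \<mu>"
    then have "(\<integral>\<^sup>+x. 1 * indicator B x \<partial>\<mu>) = emeasure N {\<omega> \<in> space N. X \<omega> \<in> B}"
      by (simp add: \<mu>e)
    then show "(\<integral>\<^sup>+x. F q x * indicator B x \<partial>\<mu>) \<le> (\<integral>\<^sup>+x. 1 * indicator B x \<partial>\<mu>)"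
      using B by (simp add: F) (intro emeasure_mono, auto)
  qed auto
  define Q where "Q = \<rat> \<inter> {0..1::real}"
  have Q: "countable Q" "Q \<noteq> {}" unfolding Q_def using countable_rat by auto
  define W where "W x u = (INF q\<in>Q. if ennreal u \<le> F q x then q else 1)" for x u
  have bdd: "bdd_below ((\<lambda>q. if ennreal u \<le> F q x then q else 1) ` Q)" for x u
    by (intro bdd_belowI[of _ 0]) (auto simp: Q_def)
  have W_iff: "W x u < t \<longleftrightarrow> (\<exists>q\<in>Q. (if ennreal u \<le> F q x then q else 1) < t)" for x u t
    unfolding W_def using Q bdd by (intro cINF_less_iff) auto
  have W_m[measurable]: "(\<lambda>(x, u). W x u) \<in> M \<Otimes>\<^sub>M borel \<rightarrow>\<^sub>M borel"
    unfolding W_def case_prod_beta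
    using Q(1) bdd by (intro borel_measurable_cINF) auto
  have ae: "AE x in \<mu>. \<forall>q\<in>Q. F q x \<le> 1 \<and> (\<forall>q'\<in>Q. q \<le> q' \<longrightarrow> F q x \<le> F q' x)"
    using Q(1) mono le1 by (auto simp: AE_ball_countable AE_conj_iff)
  let ?U = "uniform_measure lborel {0..1::real}"
  interpret U: prob_space ?U by (rule prob_space_uniform_measure) auto
  show ?thesis
  proof (rule that[OF W_m], goal_cases)
    case (1 B t)
    then have [measurable]: "B \<in> sets M" .
    have "emeasure N {\<omega> \<in> space N. X \<omega> \<in> B \<and> Z \<omega> < t}
      = (\<integral>\<^sup>+x. emeasure ?U {u. W x u < t} * indicator B x \<partial>\<mu>)"
    proof (cases "0 < t \<and> t \<le> 1")
      case False
      then consider "t \<le> 0" | "t > 1" by linarith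
      then show ?thesis
      proof cases
        case 1
        then have e1: "{\<omega> \<in> space N. X \<omega> \<in> B \<and> Z \<omega> < t} = {}" using Z01 by fastforce
        have e2: "{u. W x u < t} = {}" for x using 1 by (auto simp: W_iff Q_def)
        show ?thesis unfolding e1 e2 by simp
      next
        case 2
        have "W x u < t" for x u
        proof -
          obtain q where "q \<in> Q" using Q(2) by auto
          then show ?thesis using 2 unfolding W_iff by (intro bexI[of _ q]) (auto simp: Q_def)
        qed
        moreover have "{\<omega> \<in> space N. X \<omega> \<in> B \<and> Z \<omega> < t} = {\<omega> \<in> space N. X \<omega> \<in> B}"
          using Z01 2 by fastforce
        ultimately show ?thesis using U.emeasure_space_1 by (simp add: \<mu>e)
      qed
    next
      case True
      define e where "e = from_nat_into {q \<in> Q. q < t}"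
      have ne: "{q \<in> Q. q < t} \<noteq> {}" using True by (auto simp: Q_def intro: exI[of _ 0])
      have cnt: "countable {q \<in> Q. q < t}" using Q(1) by (rule countable_subset[rotated]) auto
      \<comment> \<open>A monotone sequence, cofinal in the rational levels below \<open>t\<close>.\<close>
      define q where "q k = Max (e ` {..k})" for k :: nat
      have q: "q k \<in> Q" "q k < t" for k
      proof -
        have "q k \<in> e ` {..k}" unfolding q_def by (intro Max_in) auto
        then show "q k \<in> Q" "q k < t" using from_nat_into[OF ne] unfolding e_def by auto
      qed
      have q_mono: "incseq q" unfolding q_def by (intro incseq_SucI Max_mono) auto
      have q_cofinal: "\<exists>k. r \<le> q k" if "r \<in> Q" "r < t" for r
      proof -
        from that obtain k where "e k = r" using from_nat_into_surj[OF cnt, of r] unfolding e_def by auto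
        then show ?thesis unfolding q_def by (intro exI[of _ k] Max_ge) auto
      qed
      have "AE x in \<mu>. emeasure ?U {u. W x u < t} = (SUP k. F (q k) x)"
        using ae
      proof eventually_elim
        case (elim x)
        have inc: "F (q k) x \<le> F (q l) x" if "k \<le> l" for k l
          using elim q incseqD[OF q_mono that] by auto
        have eq: "{u. W x u < t} = (\<Union>k. {u. ennreal u \<le> F (q k) x})"
        proof (intro set_eqI iffI)
          fix u assume "u \<in> {u. W x u < t}"
          then obtain r where r: "r \<in> Q" "(if ennreal u \<le> F r x then r else 1) < t" by (auto simp: W_iff)
          with True have r2: "ennreal u \<le> F r x" "r < t" by (auto split: if_splits)
          from q_cofinal[OF r(1) r2(2)] obtain k where "r \<le> q k" ..
          with elim r(1) q have "F r x \<le> F (q k) x" by auto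
          with r2 show "u \<in> (\<Union>k. {u. ennreal u \<le> F (q k) x})" by (auto intro: order_trans)
        qed (use q in \<open>force simp: W_iff\<close>)
        have "emeasure ?U (\<Union>k. {u. ennreal u \<le> F (q k) x}) = (SUP k. emeasure ?U {u. ennreal u \<le> F (q k) x})"
          using inc by (intro SUP_emeasure_incseq[symmetric]) (auto simp: incseq_def intro: order_trans)
        moreover have "emeasure ?U {u. ennreal u \<le> F (q k) x} = F (q k) x" for k
        proof -
          have F1: "F (q k) x \<le> 1" using elim q by auto
          then obtain c where c: "F (q k) x = ennreal c" "0 \<le> c"
            by (cases "F (q k) x") (auto simp: top_unique)
          with F1 have "c \<le> 1" by simp
          have "emeasure ?U {u. ennreal u \<le> F (q k) x} = emeasure lborel ({0..1} \<inter> {u. ennreal u \<le> F (q k) x})"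
            by (subst emeasure_uniform_measure) (auto simp: divide_ennreal_def)
          also have "{0..1} \<inter> {u. ennreal u \<le> F (q k) x} = {0..c}"
            using c \<open>c \<le> 1\<close> by (auto simp: ennreal_le_iff)
          finally show ?thesis using c by simp
        qed
        ultimately show ?case unfolding eq by simp
      qed
      then have "(\<integral>\<^sup>+x. emeasure ?U {u. W x u < t} * indicator B x \<partial>\<mu>)
          = (\<integral>\<^sup>+x. (SUP k. F (q k) x * indicator B x) \<partial>\<mu>)"
        by (intro nn_integral_cong_AE) (auto simp: SUP_mult_right_ennreal elim!: eventually_mono)
      also have "\<dots> = (SUP k. \<integral>\<^sup>+x. F (q k) x * indicator B x \<partial>\<mu>)"
      proof (rule nn_integral_monotone_convergence_SUP_AE)
        show "AE x in \<mu>. F (q k) x * indicator B x \<le> F (q (Suc k)) x * indicator B x" for k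
          using ae by eventually_elim (use q incseq_SucD[OF q_mono, of k] in \<open>auto intro!: mult_right_mono\<close>)
      qed measurable
      also have "\<dots> = (SUP k. emeasure N {\<omega> \<in> space N. X \<omega> \<in> B \<and> Z \<omega> \<le> q k})"
        by (simp add: F)
      also have "\<dots> = emeasure N (\<Union>k. {\<omega> \<in> space N. X \<omega> \<in> B \<and> Z \<omega> \<le> q k})"
        using incseqD[OF q_mono] by (intro SUP_emeasure_incseq) (auto simp: incseq_def intro: order_trans)
      also have "(\<Union>k. {\<omega> \<in> space N. X \<omega> \<in> B \<and> Z \<omega> \<le> q k}) = {\<omega> \<in> space N. X \<omega> \<in> B \<and> Z \<omega> < t}"
      proof (intro set_eqI iffI)
        fix \<omega> assume w: "\<omega> \<in> {\<omega> \<in> space N. X \<omega> \<in> B \<and> Z \<omega> < t}"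
        then obtain r where r: "r \<in> \<rat>" "Z \<omega> < r" "r < t" using Rats_dense_in_real[of "Z \<omega>" t] by auto
        with w Z01[of \<omega>] True have "r \<in> Q" by (auto simp: Q_def)
        from q_cofinal[OF this r(3)] obtain k where "r \<le> q k" ..
        with r(2) have "Z \<omega> \<le> q k" by simp
        with w show "\<omega> \<in> (\<Union>k. {\<omega> \<in> space N. X \<omega> \<in> B \<and> Z \<omega> \<le> q k})" by auto
      qed (use q in \<open>auto intro: le_less_trans\<close>)
      finally show ?thesis ..
    qed
    then show ?case unfolding \<mu>_def .
  qed
qed

text \<open>
  The real case applies to the code \<open>h \<circ> Y\<close>, and the resulting kernel is pushed forward by
  the decoding map \<open>g\<close>. The half-lines on which the real case identifies the laws
  generate the Borel sets.
\<close>

theorem regular_conditional_distribution: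
  fixes N :: "'c measure" and M :: "'b measure" and Y :: "'c \<Rightarrow> 'a::polish_space"
  assumes N: "prob_space N" and X[measurable]: "X \<in> N \<rightarrow>\<^sub>M M" and Y[measurable]: "Y \<in> borel_measurable N"
  obtains \<kappa> where "\<kappa> \<in> M \<rightarrow>\<^sub>M prob_algebra borel"
    "\<And>A B. A \<in> sets borel \<Longrightarrow> B \<in> sets M \<Longrightarrow> emeasure N {\<omega> \<in> space N. X \<omega> \<in> B \<and> Y \<omega> \<in> A}
      = (\<integral>\<^sup>+x. emeasure (\<kappa> x) A * indicator B x \<partial>distr N M X)"
proof -
  interpret N: prob_space N by fact
  obtain h :: "'a \<Rightarrow> real" and g where [measurable]: "h \<in> borel_measurable borel" "g \<in> borel_measurable borel"
    and gh: "\<And>y. g (h y) = y" and h01: "\<And>y. 0 \<le> h y \<and> h y \<le> 1"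
    using polish_retract_of_real by metis
  obtain W :: "'b \<Rightarrow> real \<Rightarrow> real" where W[measurable]: "(\<lambda>(x, u). W x u) \<in> M \<Otimes>\<^sub>M borel \<rightarrow>\<^sub>M borel"
    and W_eq: "\<And>B t. B \<in> sets M \<Longrightarrow> emeasure N {\<omega> \<in> space N. X \<omega> \<in> B \<and> h (Y \<omega>) < t}
      = (\<integral>\<^sup>+x. emeasure (uniform_measure lborel {0..1}) {u. W x u < t} * indicator B x \<partial>distr N M X)"
  proof (rule regular_conditional_distribution_real[OF N X, of "\<lambda>\<omega>. h (Y \<omega>)"], goal_cases)
    case (3 W)
    show ?case by (rule 3(1)[OF 3(2,3)])
  qed (use h01 in auto)
  let ?U = "uniform_measure lborel {0..1::real}"
  interpret U: prob_space ?U by (rule prob_space_uniform_measure) auto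
  have U: "(\<lambda>_. ?U) \<in> M \<rightarrow>\<^sub>M prob_algebra borel"
    using U.prob_space_axioms by (intro measurable_const) (simp add: space_prob_algebra)
  have WU[measurable]: "(\<lambda>x. distr ?U borel (W x)) \<in> M \<rightarrow>\<^sub>M prob_algebra borel"
    by (rule measurable_distr_prob_space2[OF U W])
  have W1[measurable]: "W x \<in> borel_measurable borel" if "x \<in> space M" for x
    using measurable_compose[OF measurable_Pair1'[OF that] W] by simp
  define \<kappa> where "\<kappa> x = distr ?U borel (\<lambda>u. g (W x u))" for x
  show ?thesis
  proof (rule that)
    show "\<kappa> \<in> M \<rightarrow>\<^sub>M prob_algebra borel"
      unfolding \<kappa>_def by (rule measurable_distr_prob_space2[OF U]) measurable
    fix A :: "'a set" and B assume A[measurable]: "A \<in> sets borel" and B[measurable]: "B \<in> sets M"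
    \<comment> \<open>The two sides of the claim as measures on the line, for a fixed \<open>B\<close>.\<close>
    define R1 where "R1 = distr (density N (indicator (X -` B \<inter> space N))) borel (\<lambda>\<omega>. h (Y \<omega>))"
    define R2 where "R2 = density (distr N M X) (indicator B) \<bind> (\<lambda>x. distr ?U borel (W x))"
    from N.not_empty obtain \<omega> where "\<omega> \<in> space N" by auto
    then have ne: "space M \<noteq> {}" using measurable_space[OF X] by blast
    have R1: "emeasure R1 C = emeasure N {\<omega> \<in> space N. X \<omega> \<in> B \<and> h (Y \<omega>) \<in> C}"
      if [measurable]: "C \<in> sets borel" for C
    proof -
      have "emeasure R1 C = (\<integral>\<^sup>+\<omega>. indicator (X -` B \<inter> space N) \<omega> * indicator ((\<lambda>\<omega>. h (Y \<omega>)) -` C \<inter> space N) \<omega> \<partial>N)"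
        unfolding R1_def by (simp add: emeasure_distr emeasure_density)
      also have "\<dots> = (\<integral>\<^sup>+\<omega>. indicator {\<omega> \<in> space N. X \<omega> \<in> B \<and> h (Y \<omega>) \<in> C} \<omega> \<partial>N)"
        by (intro nn_integral_cong) (auto simp: indicator_def)
      also have "\<dots> = emeasure N {\<omega> \<in> space N. X \<omega> \<in> B \<and> h (Y \<omega>) \<in> C}" by simp
      finally show ?thesis .
    qed
    have R2: "emeasure R2 C = (\<integral>\<^sup>+x. emeasure ?U (W x -` C) * indicator B x \<partial>distr N M X)"
      if [measurable]: "C \<in> sets borel" for C
    proof -
      have "emeasure R2 C = (\<integral>\<^sup>+x. emeasure (distr ?U borel (W x)) C \<partial>density (distr N M X) (indicator B))"
        unfolding R2_def using ne measurable_prob_algebraD[OF WU]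
        by (intro emeasure_bind[where N = borel]) (auto cong: measurable_cong_sets)
      also have "\<dots> = (\<integral>\<^sup>+x. indicator B x * emeasure (distr ?U borel (W x)) C \<partial>distr N M X)"
        using measurable_compose[OF measurable_prob_algebraD[OF WU] measurable_emeasure_subprob_algebra[OF that]]
        by (intro nn_integral_density) (auto cong: measurable_cong_sets)
      also have "\<dots> = (\<integral>\<^sup>+x. emeasure ?U (W x -` C) * indicator B x \<partial>distr N M X)"
        by (intro nn_integral_cong) (simp add: emeasure_distr mult.commute)
      finally show ?thesis .
    qed
    have "R1 = R2"
    proof (rule measure_eqI_generator_eq[where E = "range lessThan" and \<Omega> = UNIV and A = "\<lambda>n. {..<real n}"])
      show "Int_stable (range lessThan :: real set set)"
        proof (rule Int_stableI)
        fix S T :: "real set" assume "S \<in> range lessThan" "T \<in> range lessThan"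
        then obtain a b where "S = {..<a}" "T = {..<b}" by auto
        then have "S \<inter> T = {..<min a b}" by auto
        then show "S \<inter> T \<in> range lessThan" by simp
      qed
      have borel: "sets borel = sigma_sets UNIV (range lessThan :: real set set)"
        by (subst borel_Iio) simp
      have "sets R2 = sets borel"
        unfolding R2_def using ne measurable_prob_algebraD[OF WU]
        by (intro sets_bind_measurable) (auto cong: measurable_cong_sets)
      then show "sets R1 = sigma_sets UNIV (range lessThan)" "sets R2 = sigma_sets UNIV (range lessThan)"
        unfolding borel[symmetric] by (simp_all add: R1_def)
      show "emeasure R1 C = emeasure R2 C" if "C \<in> range lessThan" for C
        using that W_eq[OF B] by (auto simp: R1 R2 vimage_def)
      show "(\<Union>n. {..<real n}) = UNIV" using reals_Archimedean2 by auto
      show "emeasure R1 {..<real n} \<noteq> \<infinity>" for n by (simp add: R1 N.emeasure_eq_measure)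
    qed auto
    have "emeasure N {\<omega> \<in> space N. X \<omega> \<in> B \<and> Y \<omega> \<in> A} = emeasure R1 (g -` A)"
      using measurable_sets[of g borel borel A] by (simp add: R1 gh)
    also have "\<dots> = (\<integral>\<^sup>+x. emeasure ?U (W x -` (g -` A)) * indicator B x \<partial>distr N M X)"
      using measurable_sets[of g borel borel A] by (simp add: R2 \<open>R1 = R2\<close>)
    also have "\<dots> = (\<integral>\<^sup>+x. emeasure (\<kappa> x) A * indicator B x \<partial>distr N M X)"
      unfolding \<kappa>_def by (intro nn_integral_cong) (simp add: emeasure_distr vimage_def)
    finally show "emeasure N {\<omega> \<in> space N. X \<omega> \<in> B \<and> Y \<omega> \<in> A}
      = (\<integral>\<^sup>+x. emeasure (\<kappa> x) A * indicator B x \<partial>distr N M X)" .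
  qed
qed

section \<open>Existence of disintegrations\<close>

abbreviation kernel_product :: "(nat \<Rightarrow> (nat \<Rightarrow> 'a::topological_space) \<Rightarrow> 'a measure) \<Rightarrow> nat \<Rightarrow> (nat \<Rightarrow> 'a) measure" where
  "kernel_product \<kappa> n \<equiv> Ionescu_Tulcea.C \<kappa> (\<lambda>_. borel) 0 n (\<lambda>_. undefined)"

lemma Ionescu_Tulcea_kernels:
  assumes "\<And>k. \<kappa> k \<in> power_space k \<rightarrow>\<^sub>M prob_algebra borel"
  shows "Ionescu_Tulcea \<kappa> (\<lambda>_. borel)"
  using assms disintegration_Ionescu_Tulcea[of 0 "kernel_product \<kappa> 0" \<kappa>]
  by (auto simp: disintegration_def)

lemma undefined_in_power_space: "(\<lambda>_. undefined) \<in> space (power_space 0)"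
  by (simp add: space_PiM)

lemma measurable_snoc: "(\<lambda>(x, y). x(n := y)) \<in> power_space n \<Otimes>\<^sub>M borel \<rightarrow>\<^sub>M power_space (Suc n)"
  using measurable_add_dim[of n "{0..<n}" "\<lambda>_. borel"] by (simp add: atLeastLessThanSuc)

lemma kernel_product_Suc:
  assumes K: "\<And>k. \<kappa> k \<in> power_space k \<rightarrow>\<^sub>M prob_algebra borel"
  shows "kernel_product \<kappa> (Suc n)
    = kernel_product \<kappa> n \<bind> (\<lambda>x. distr (\<kappa> n x) (power_space (Suc n)) (\<lambda>y. x(n := y)))"
proof -
  interpret IT: Ionescu_Tulcea \<kappa> "\<lambda>_. borel" using K by (rule Ionescu_Tulcea_kernels)
  show ?thesis by (simp add: IT.eP_def[abs_def])
qed

lemma kernel_product_in_prob_algebra: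
  assumes K: "\<And>k. \<kappa> k \<in> power_space k \<rightarrow>\<^sub>M prob_algebra borel"
  shows "kernel_product \<kappa> n \<in> space (prob_algebra (power_space n))"
proof -
  interpret IT: Ionescu_Tulcea \<kappa> "\<lambda>_. borel" using K by (rule Ionescu_Tulcea_kernels)
  show ?thesis
    using IT.prob_space_C[OF undefined_in_power_space, of n] IT.sets_C[OF undefined_in_power_space, of n]
    by (simp add: space_prob_algebra)
qed

lemma measurable_snoc_kernel:
  assumes "\<kappa> \<in> power_space n \<rightarrow>\<^sub>M prob_algebra borel"
  shows "(\<lambda>x. distr (\<kappa> x) (power_space (Suc n)) (\<lambda>y. x(n := y)))
    \<in> power_space n \<rightarrow>\<^sub>M prob_algebra (power_space (Suc n))"
  by (rule measurable_distr_prob_space2[OF assms measurable_snoc])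

lemma kernel_product_cong:
  assumes K: "\<And>k. \<kappa> k \<in> power_space k \<rightarrow>\<^sub>M prob_algebra borel"
    and K': "\<And>k. \<kappa>' k \<in> power_space k \<rightarrow>\<^sub>M prob_algebra borel"
    and "\<And>k. k < n \<Longrightarrow> \<kappa> k = \<kappa>' k"
  shows "kernel_product \<kappa> n = kernel_product \<kappa>' n"
proof -
  interpret IT: Ionescu_Tulcea \<kappa> "\<lambda>_. borel" using K by (rule Ionescu_Tulcea_kernels)
  interpret IT': Ionescu_Tulcea \<kappa>' "\<lambda>_. borel" using K' by (rule Ionescu_Tulcea_kernels)
  show ?thesis
    using assms(3) by (induction n) (simp_all only: kernel_product_Suc[OF K] kernel_product_Suc[OF K']
      IT.C.simps(1) IT'.C.simps(1) less_Suc_eq simp_thms)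
qed

lemma kernel_product_marginal:
  assumes K: "\<And>k. \<kappa> k \<in> power_space k \<rightarrow>\<^sub>M prob_algebra borel" and "k \<le> n"
  shows "kernel_product \<kappa> k = distr (kernel_product \<kappa> n) (power_space k) (\<lambda>x. restrict x {0..<k})"
proof -
  interpret IT: Ionescu_Tulcea \<kappa> "\<lambda>_. borel" using K by (rule Ionescu_Tulcea_kernels)
  show ?thesis using IT.distr_C[OF assms(2) undefined_in_power_space] by simp
qed

text \<open>
  Induction on the length: the marginal on the first \<open>n\<close> coordinates is disintegrated by
  hypothesis, and the last kernel is the regular conditional distribution of the last
  coordinate given the others.
\<close>

theorem disintegration_exists:
  fixes \<nu> :: "(nat \<Rightarrow> 'a::polish_space) measure"
  assumes "\<nu> \<in> space (prob_algebra (power_space n))"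
  shows "\<exists>\<kappa>. disintegration n \<nu> \<kappa>"
  using assms
proof (induction n arbitrary: \<nu>)
  case (0 \<nu>)
  define \<kappa> :: "nat \<Rightarrow> (nat \<Rightarrow> 'a) \<Rightarrow> 'a measure" where "\<kappa> = (\<lambda>_ _. return borel undefined)"
  have K: "\<kappa> k \<in> power_space k \<rightarrow>\<^sub>M prob_algebra borel" for k
    unfolding \<kappa>_def by (intro measurable_const) (simp add: space_prob_algebra prob_space_return)
  interpret IT: Ionescu_Tulcea \<kappa> "\<lambda>_. borel" using K by (rule Ionescu_Tulcea_kernels)
  interpret prob_space \<nu> using 0 by (simp add: space_prob_algebra)
  have s: "sets \<nu> = sets (PiM {} (\<lambda>_. borel))" using 0 by (simp add: space_prob_algebra)
  have "\<nu> = return (PiM {} (\<lambda>_. borel)) (\<lambda>_. undefined)"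
  proof (rule measure_eqI)
    fix A assume "A \<in> sets \<nu>"
    then have "A = {} \<or> A = {\<lambda>_. undefined}" unfolding s by (auto simp: sets_PiM_empty)
    moreover have "space \<nu> = {\<lambda>_. undefined}"
      using sets_eq_imp_space_eq[OF s] by (simp add: space_PiM)
    ultimately show "emeasure \<nu> A = emeasure (return (PiM {} (\<lambda>_. borel)) (\<lambda>_. undefined)) A"
      using emeasure_space_1 by (auto simp: sets_PiM_empty)
  qed (simp add: s)
  then have "disintegration 0 \<nu> \<kappa>" using K by (simp add: disintegration_def)
  then show ?case by (intro exI[of _ \<kappa>])
next
  case (Suc n \<nu>)
  interpret prob_space \<nu> using Suc.prems by (simp add: space_prob_algebra)
  have s[measurable_cong]: "sets \<nu> = sets (power_space (Suc n))"
    using Suc.prems by (simp add: space_prob_algebra)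
  have r[measurable]: "(\<lambda>x. restrict x {0..<n}) \<in> \<nu> \<rightarrow>\<^sub>M power_space n"
    unfolding measurable_cong_sets[OF s refl] by (rule measurable_restrict_subset) auto
  have c[measurable]: "(\<lambda>x. x n) \<in> \<nu> \<rightarrow>\<^sub>M borel"
    unfolding measurable_cong_sets[OF s refl] by (rule measurable_component_singleton) simp
  note measurable_snoc[of n, where 'a = 'a, measurable]
  define \<nu>' where "\<nu>' = distr \<nu> (power_space n) (\<lambda>x. restrict x {0..<n})"
  have \<nu>': "\<nu>' \<in> space (prob_algebra (power_space n))"
    unfolding \<nu>'_def using prob_space_distr[OF r] by (simp add: space_prob_algebra)
  obtain \<kappa> where \<kappa>: "disintegration n \<nu>' \<kappa>" using Suc.IH[OF \<nu>'] by auto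
  obtain \<kappa>n where \<kappa>n[measurable]: "\<kappa>n \<in> power_space n \<rightarrow>\<^sub>M prob_algebra (borel :: 'a measure)"
    and rcd: "\<And>A B. A \<in> sets borel \<Longrightarrow> B \<in> sets (power_space n) \<Longrightarrow>
      emeasure \<nu> {x \<in> space \<nu>. restrict x {0..<n} \<in> B \<and> x n \<in> A} = (\<integral>\<^sup>+x. emeasure (\<kappa>n x) A * indicator B x \<partial>\<nu>')"
  proof (rule regular_conditional_distribution[OF prob_space_axioms r c], goal_cases)
    case (1 \<kappa>)
    show ?case by (rule 1(1)[OF 1(2) 1(3)[folded \<nu>'_def]])
  qed
  define \<kappa>' where "\<kappa>' = \<kappa>(n := \<kappa>n)"
  have K: "\<kappa> k \<in> power_space k \<rightarrow>\<^sub>M prob_algebra borel" for k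
    using \<kappa> by (simp add: disintegration_def)
  then have K': "\<kappa>' k \<in> power_space k \<rightarrow>\<^sub>M prob_algebra borel" for k
    using \<kappa>n by (simp add: \<kappa>'_def)
  have \<nu>'_eq: "kernel_product \<kappa>' n = \<nu>'"
  proof -
    have "kernel_product \<kappa>' n = kernel_product \<kappa> n"
      by (rule kernel_product_cong[OF K' K]) (simp add: \<kappa>'_def)
    with \<kappa> show ?thesis by (simp add: disintegration_def)
  qed
  have ne: "space \<nu>' \<noteq> {}"
    using \<nu>' by (simp add: space_prob_algebra prob_space.not_empty)
  have \<nu>'s[measurable_cong]: "sets \<nu>' = sets (power_space n)" by (simp add: \<nu>'_def)
  \<comment> \<open>The joint law of past and last coordinate, and its reconstruction from the kernel.\<close>
  define P where "P = distr \<nu> (power_space n \<Otimes>\<^sub>M borel) (\<lambda>x. (restrict x {0..<n}, x n))"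
  define R where "R = \<nu>' \<bind> (\<lambda>x. distr (\<kappa>n x) (power_space n \<Otimes>\<^sub>M borel) (\<lambda>y. (x, y)))"
  have ker: "(\<lambda>x. distr (\<kappa>n x) (power_space n \<Otimes>\<^sub>M borel) (\<lambda>y. (x, y)))
      \<in> power_space n \<rightarrow>\<^sub>M prob_algebra (power_space n \<Otimes>\<^sub>M borel)"
    by (rule measurable_distr_prob_space2[OF \<kappa>n]) measurable
  let ?E = "{a \<times> b |a b. a \<in> sets (power_space n :: (nat \<Rightarrow> 'a) measure) \<and> b \<in> sets (borel :: 'a measure)}"
  have "P = R"
  proof (rule measure_eqI_generator_eq[where E = ?E and \<Omega> = "space (power_space n) \<times> space borel"
        and A = "\<lambda>_. space (power_space n) \<times> space borel"])
    show "Int_stable ?E" by (rule Int_stable_pair_measure_generator)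
    show "?E \<subseteq> Pow (space (power_space n) \<times> space borel)" by (rule pair_measure_closed)
    show "sets P = sigma_sets (space (power_space n) \<times> space borel) ?E"
      by (simp add: P_def sets_pair_measure)
    have "sets R = sets (power_space n \<Otimes>\<^sub>M borel)"
      unfolding R_def by (rule sets_bind'[OF \<nu>' ker])
    then show "sets R = sigma_sets (space (power_space n) \<times> space borel) ?E"
      by (simp add: sets_pair_measure)
    fix C assume "C \<in> ?E"
    then obtain a b where C: "C = a \<times> b" and [measurable]: "a \<in> sets (power_space n)" "b \<in> sets (borel :: 'a measure)"
      by auto
    have "emeasure P C = emeasure \<nu> {x \<in> space \<nu>. restrict x {0..<n} \<in> a \<and> x n \<in> b}"
      unfolding P_def C by (subst emeasure_distr) (auto intro!: arg_cong[of _ _ "emeasure \<nu>"])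
    also have "\<dots> = (\<integral>\<^sup>+x. emeasure (\<kappa>n x) b * indicator a x \<partial>\<nu>')" by (rule rcd) measurable
    also have "\<dots> = (\<integral>\<^sup>+x. emeasure (distr (\<kappa>n x) (power_space n \<Otimes>\<^sub>M borel) (\<lambda>y. (x, y))) C \<partial>\<nu>')"
    proof (rule nn_integral_cong)
      fix x assume "x \<in> space \<nu>'"
      then have x: "x \<in> space (power_space n)" using sets_eq_imp_space_eq[OF \<nu>'s] by simp
      have sk[measurable_cong]: "sets (\<kappa>n x) = sets borel"
        using measurable_space[OF \<kappa>n x] by (simp add: space_prob_algebra)
      have "(\<lambda>y. (x, y)) \<in> \<kappa>n x \<rightarrow>\<^sub>M power_space n \<Otimes>\<^sub>M borel"
        using measurable_Pair1'[OF x] by (simp add: measurable_cong_sets[OF sk refl])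
      then have "emeasure (distr (\<kappa>n x) (power_space n \<Otimes>\<^sub>M borel) (\<lambda>y. (x, y))) C
          = emeasure (\<kappa>n x) ((\<lambda>y. (x, y)) -` C \<inter> space (\<kappa>n x))"
        unfolding C by (rule emeasure_distr) measurable
      also have "(\<lambda>y. (x, y)) -` C \<inter> space (\<kappa>n x) = (if x \<in> a then b else {})"
        using sets_eq_imp_space_eq[OF sk] by (auto simp: C)
      finally show "emeasure (\<kappa>n x) b * indicator a x
          = emeasure (distr (\<kappa>n x) (power_space n \<Otimes>\<^sub>M borel) (\<lambda>y. (x, y))) C" by simp
    qed
    also have "\<dots> = emeasure R C"
      unfolding R_def C by (rule emeasure_bind_prob_algebra[OF \<nu>' ker, symmetric]) measurable
    finally show "emeasure P C = emeasure R C" .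
  next
    show "emeasure P (space (power_space n) \<times> space borel) \<noteq> \<infinity>"
      unfolding P_def by (subst emeasure_distr) (auto simp: emeasure_eq_measure)
  qed (use sets.top[of "power_space n"] sets.top[of borel] in blast)+
  have "\<nu> = distr P (power_space (Suc n)) (\<lambda>(x, y). x(n := y))"
  proof -
    have "distr P (power_space (Suc n)) (\<lambda>(x, y). x(n := y))
        = distr \<nu> (power_space (Suc n)) (\<lambda>x. (restrict x {0..<n})(n := x n))"
      unfolding P_def by (subst distr_distr) (auto simp: comp_def)
    also have "\<dots> = distr \<nu> (power_space (Suc n)) (\<lambda>x. x)"
    proof (rule distr_cong)
      fix x assume "x \<in> space \<nu>"
      then have "x \<in> extensional {0..<Suc n}"
        using sets_eq_imp_space_eq[OF s] by (simp add: space_PiM PiE_def)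
      then show "(restrict x {0..<n})(n := x n) = x"
        by (auto simp: fun_eq_iff extensional_def restrict_def)
    qed auto
    also have "\<dots> = \<nu>" by (rule distr_id2) (simp add: s)
    finally show ?thesis ..
  qed
  also have "\<dots> = \<nu>' \<bind> (\<lambda>x. distr (distr (\<kappa>n x) (power_space n \<Otimes>\<^sub>M borel) (\<lambda>y. (x, y))) (power_space (Suc n)) (\<lambda>(x, y). x(n := y)))"
    unfolding \<open>P = R\<close> R_def
    using measurable_prob_algebraD[OF ker] ne
    by (intro distr_bind[where K = "power_space n \<Otimes>\<^sub>M borel"]) (auto cong: measurable_cong_sets)
  also have "\<dots> = \<nu>' \<bind> (\<lambda>x. distr (\<kappa>n x) (power_space (Suc n)) (\<lambda>y. x(n := y)))"
  proof (rule bind_cong[OF refl])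
    fix x assume "x \<in> space \<nu>'"
    then have x: "x \<in> space (power_space n)" using sets_eq_imp_space_eq[OF \<nu>'s] by simp
    have sk[measurable_cong]: "sets (\<kappa>n x) = sets borel"
      using measurable_space[OF \<kappa>n x] by (simp add: space_prob_algebra)
    have "(\<lambda>y. (x, y)) \<in> \<kappa>n x \<rightarrow>\<^sub>M power_space n \<Otimes>\<^sub>M borel"
        using measurable_Pair1'[OF x] by (simp add: measurable_cong_sets[OF sk refl])
    then show "distr (distr (\<kappa>n x) (power_space n \<Otimes>\<^sub>M borel) (\<lambda>y. (x, y))) (power_space (Suc n)) (\<lambda>(x, y). x(n := y))
        = distr (\<kappa>n x) (power_space (Suc n)) (\<lambda>y. x(n := y))"
      by (subst distr_distr) (auto simp: comp_def)
  qed
  also have "\<dots> = kernel_product \<kappa>' (Suc n)"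
    unfolding kernel_product_Suc[OF K'] \<nu>'_eq by (simp add: \<kappa>'_def)
  finally have "disintegration (Suc n) \<nu> \<kappa>'" using K' by (simp only: disintegration_def) simp
  then show ?case by (intro exI[of _ \<kappa>'])
qed

section \<open>Uniqueness of disintegrations and second moments of innovations\<close>

text \<open>
  Finite intersections of basic open sets. Two kernels that agree almost surely on each set
  of a countable generator closed under intersections agree almost surely as measures.
\<close>

lemma borel_countable_generator:
  obtains G :: "'a::second_countable_topology set set" where
    "countable G" "Int_stable G" "UNIV \<in> G" "sets borel = sigma_sets UNIV G"
proof -
  obtain B :: "'a set set" where B: "countable B" "topological_basis B"
    using ex_countable_basis by auto
  define G where "G = Inter ` {F. finite F \<and> F \<subseteq> B}"
  show ?thesis
  proof (rule that)
    show "countable G" unfolding G_def using B(1) by (intro countable_image countable_Collect_finite_subset)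
    show "Int_stable G"
    proof (rule Int_stableI)
      fix S T assume "S \<in> G" "T \<in> G"
      then obtain F F' where "finite F" "F \<subseteq> B" "S = \<Inter>F" "finite F'" "F' \<subseteq> B" "T = \<Inter>F'"
        unfolding G_def by auto
      then show "S \<inter> T \<in> G" unfolding G_def by (intro image_eqI[of _ _ "F \<union> F'"]) auto
    qed
    show "UNIV \<in> G" unfolding G_def by (intro image_eqI[of _ _ "{}"]) auto
    have op: "open S" if "S \<in> G" for S
      using that topological_basis_open[OF B(2)] unfolding G_def by (auto intro!: open_Inter)
    have "B \<subseteq> G" unfolding G_def by (intro subsetI image_eqI[of _ _ "{_}"]) auto
    then have "sigma_sets UNIV B \<subseteq> sigma_sets UNIV G" by (rule sigma_sets_mono')
    moreover have "sets borel = sigma_sets UNIV B"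
      by (subst borel_eq_countable_basis[OF B]) simp
    moreover have "sigma_sets UNIV G \<subseteq> sets borel"
    proof -
      have "G \<subseteq> sets borel" using op by auto
      from sets.sigma_sets_subset[OF this] show ?thesis by simp
    qed
    ultimately show "sets borel = sigma_sets UNIV G" by simp
  qed
qed

text \<open>
  Integrating \<open>\<kappa> k x A\<close> over \<open>x \<in> B\<close> gives the probability of a rectangle under the
  law of the first \<open>Suc k\<close> coordinates, which is the same for both kernels.
\<close>

lemma AE_kernels_le_on_set:
  assumes K: "\<And>k. \<kappa> k \<in> power_space k \<rightarrow>\<^sub>M prob_algebra borel"
    and K': "\<And>k. \<kappa>' k \<in> power_space k \<rightarrow>\<^sub>M prob_algebra borel"
    and k: "kernel_product \<kappa> k = kernel_product \<kappa>' k"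
    and Sk: "kernel_product \<kappa> (Suc k) = kernel_product \<kappa>' (Suc k)"
    and A[measurable]: "A \<in> sets borel"
  shows "AE x in kernel_product \<kappa> k. emeasure (\<kappa> k x) A \<le> emeasure (\<kappa>' k x) A"
proof -
  note p = kernel_product_in_prob_algebra[where n = k]
  interpret prob_space "kernel_product \<kappa> k" using p[OF K] by (simp add: space_prob_algebra)
  have s[measurable_cong]: "sets (kernel_product \<kappa> k) = sets (power_space k)"
    using p[OF K] by (simp add: space_prob_algebra)
  have m: "(\<lambda>x. emeasure (\<eta> k x) A) \<in> borel_measurable (kernel_product \<kappa> k)"
    if "\<And>k. \<eta> k \<in> power_space k \<rightarrow>\<^sub>M prob_algebra borel" for \<eta>
    using measurable_compose[OF measurable_prob_algebraD[OF that] measurable_emeasure_subprob_algebra[OF A], of k]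
    by (simp add: measurable_cong_sets[OF s refl])
  have rect: "(\<integral>\<^sup>+x. emeasure (\<kappa> k x) A * indicator B x \<partial>kernel_product \<kappa> k)
      = emeasure (kernel_product \<kappa> (Suc k)) {z \<in> space (power_space (Suc k)). restrict z {0..<k} \<in> B \<and> z k \<in> A}"
    if K: "\<And>k. \<kappa> k \<in> power_space k \<rightarrow>\<^sub>M prob_algebra borel"
      and B[measurable]: "B \<in> sets (power_space k)" for \<kappa> B
  proof -
    let ?C = "{z \<in> space (power_space (Suc k)). restrict z {0..<k} \<in> B \<and> z k \<in> A}"
    have [measurable]: "(\<lambda>z. restrict z {0..<k}) \<in> power_space (Suc k) \<rightarrow>\<^sub>M power_space k"
      by (rule measurable_restrict_subset) auto
    have [measurable]: "(\<lambda>z. z k) \<in> power_space (Suc k) \<rightarrow>\<^sub>M borel"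
      by (rule measurable_component_singleton) simp
    have C: "?C \<in> sets (power_space (Suc k))" by measurable
    have "emeasure (kernel_product \<kappa> (Suc k)) ?C
        = (\<integral>\<^sup>+x. emeasure (distr (\<kappa> k x) (power_space (Suc k)) (\<lambda>y. x(k := y))) ?C \<partial>kernel_product \<kappa> k)"
      unfolding kernel_product_Suc[OF K]
      by (rule emeasure_bind_prob_algebra[OF p[OF K] measurable_snoc_kernel[OF K] C])
    also have "\<dots> = (\<integral>\<^sup>+x. emeasure (\<kappa> k x) A * indicator B x \<partial>kernel_product \<kappa> k)"
    proof (rule nn_integral_cong)
      fix x assume "x \<in> space (kernel_product \<kappa> k)"
      then have x: "x \<in> space (power_space k)"
        using p[OF K] sets_eq_imp_space_eq[of "kernel_product \<kappa> k" "power_space k"] by (simp add: space_prob_algebra)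
      have sk: "sets (\<kappa> k x) = sets borel"
        using measurable_space[OF K x] by (simp add: space_prob_algebra)
      have xe: "restrict (x(k := y)) {0..<k} = x" for y
        using x by (auto simp: space_PiM PiE_def extensional_def fun_eq_iff restrict_def)
      have "(\<lambda>y. x(k := y)) \<in> \<kappa> k x \<rightarrow>\<^sub>M power_space (Suc k)"
        using measurable_compose[OF measurable_Pair1'[OF x] measurable_snoc]
        by (simp add: measurable_cong_sets[OF sk refl])
      then have "emeasure (distr (\<kappa> k x) (power_space (Suc k)) (\<lambda>y. x(k := y))) ?C
          = emeasure (\<kappa> k x) ((\<lambda>y. x(k := y)) -` ?C \<inter> space (\<kappa> k x))"
        using C by (rule emeasure_distr)
      also have "(\<lambda>y. x(k := y)) -` ?C \<inter> space (\<kappa> k x) = (if x \<in> B then A else {})"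
        using sets_eq_imp_space_eq[OF sk] x xe
        by (auto simp: space_PiM PiE_def extensional_def)
      also have "emeasure (\<kappa> k x) (if x \<in> B then A else {}) = emeasure (\<kappa> k x) A * indicator B x"
        by simp
      finally show "emeasure (distr (\<kappa> k x) (power_space (Suc k)) (\<lambda>y. x(k := y))) ?C
          = emeasure (\<kappa> k x) A * indicator B x" .
    qed
    finally show ?thesis ..
  qed
  have "(\<integral>\<^sup>+x. emeasure (\<kappa> k x) A \<partial>kernel_product \<kappa> k) \<le> (\<integral>\<^sup>+x. 1 \<partial>kernel_product \<kappa> k)"
  proof (rule nn_integral_mono)
    fix x assume "x \<in> space (kernel_product \<kappa> k)"
    then have "x \<in> space (power_space k)" using sets_eq_imp_space_eq[OF s] by simp
    then have "prob_space (\<kappa> k x)" using measurable_space[OF K] by (simp add: space_prob_algebra)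
    then show "emeasure (\<kappa> k x) A \<le> 1" by (rule prob_space.emeasure_le_1)
  qed
  also have "\<dots> < \<infinity>" using emeasure_space_1 by simp
  finally have fin: "(\<integral>\<^sup>+x. emeasure (\<kappa> k x) A \<partial>kernel_product \<kappa> k) < \<infinity>" .
  show ?thesis
  proof (rule AE_le_if_nn_integral_le[OF m[OF K] m[OF K'] fin])
    fix B assume "B \<in> sets (kernel_product \<kappa> k)"
    then have B: "B \<in> sets (power_space k)" using s by simp
    show "(\<integral>\<^sup>+x. emeasure (\<kappa> k x) A * indicator B x \<partial>kernel_product \<kappa> k)
        \<le> (\<integral>\<^sup>+x. emeasure (\<kappa>' k x) A * indicator B x \<partial>kernel_product \<kappa> k)"
      using rect[OF K B] rect[OF K' B] unfolding k Sk by simp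
  qed
qed

theorem disintegration_unique_AE:
  fixes \<nu> :: "(nat \<Rightarrow> 'a::second_countable_topology) measure"
  assumes "disintegration n \<nu> \<kappa>" "disintegration n \<nu> \<kappa>'" "k < n"
  shows "AE x in \<nu>. \<kappa> k (restrict x {0..<k}) = \<kappa>' k (restrict x {0..<k})"
proof -
  have K: "\<kappa> k \<in> power_space k \<rightarrow>\<^sub>M prob_algebra borel"
    and K': "\<kappa>' k \<in> power_space k \<rightarrow>\<^sub>M prob_algebra borel"
    and \<nu>: "\<nu> = kernel_product \<kappa> n" "\<nu> = kernel_product \<kappa>' n" for k
    using assms by (auto simp: disintegration_def)
  have marg: "kernel_product \<kappa> j = distr \<nu> (power_space j) (\<lambda>x. restrict x {0..<j})"
      "kernel_product \<kappa>' j = distr \<nu> (power_space j) (\<lambda>x. restrict x {0..<j})" if "j \<le> n" for j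
    using kernel_product_marginal[OF K that] kernel_product_marginal[OF K' that] \<nu> by simp_all
  obtain G :: "'a set set" where G: "countable G" "Int_stable G" "UNIV \<in> G" "sets borel = sigma_sets UNIV G"
    by (rule borel_countable_generator)
  let ?\<nu>k = "kernel_product \<kappa> k"
  have e: "kernel_product \<kappa> k = kernel_product \<kappa>' k" "kernel_product \<kappa> (Suc k) = kernel_product \<kappa>' (Suc k)"
    using assms(3) by (simp_all only: marg Suc_le_eq less_imp_le)
  have Gb: "A \<in> sets borel" if "A \<in> G" for A using that unfolding G(4) by blast
  have ae0: "AE x in ?\<nu>k. \<forall>A\<in>G. emeasure (\<kappa> k x) A = emeasure (\<kappa>' k x) A"
  proof (subst AE_ball_countable[OF G(1)], intro ballI)
    fix A assume "A \<in> G"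
    from AE_kernels_le_on_set[OF K K' e Gb[OF this]] AE_kernels_le_on_set[OF K' K e[symmetric] Gb[OF this]]
    show "AE x in ?\<nu>k. emeasure (\<kappa> k x) A = emeasure (\<kappa>' k x) A"
      unfolding e(1) by eventually_elim simp
  qed
  have sp: "space ?\<nu>k = space (power_space k)"
    using kernel_product_in_prob_algebra[OF K] by (intro sets_eq_imp_space_eq) (simp add: space_prob_algebra)
  from ae0 AE_space[of ?\<nu>k] have "AE x in ?\<nu>k. \<kappa> k x = \<kappa>' k x"
  proof eventually_elim
    case (elim x)
    then have x: "\<kappa> k x \<in> probs" "\<kappa>' k x \<in> probs"
      using measurable_space[OF K, of x] measurable_space[OF K', of x] sp by auto
    interpret prob_space "\<kappa> k x" using x by (simp add: space_prob_algebra)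
    show ?case
      using elim x G
      by (intro measure_eqI_generator_eq[where E = G and \<Omega> = UNIV and A = "\<lambda>_. UNIV"])
        (auto simp: space_prob_algebra emeasure_eq_measure)
  qed
  then have ae: "AE x in distr \<nu> (power_space k) (\<lambda>x. restrict x {0..<k}). \<kappa> k x = \<kappa>' k x"
    using assms(3) by (subst marg(1)[symmetric]) auto
  have "sets \<nu> = sets (power_space n)"
    using kernel_product_in_prob_algebra[OF K, of n] \<nu> by (simp add: space_prob_algebra)
  then have "(\<lambda>x. restrict x {0..<k}) \<in> \<nu> \<rightarrow>\<^sub>M power_space k"
    using assms(3) by (subst measurable_cong_sets[OF _ refl]) (auto intro!: measurable_restrict_subset)
  from AE_distrD[OF this ae] show ?thesis .
qed

text \<open>
  The cross term \<open>2 a (f - E f)\<close> integrates to \<open>0\<close>: orthogonality of a martingale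
  increment to the past value \<open>a\<close>.
\<close>

lemma (in prob_space) nn_integral_square_centered_le:
  fixes f :: "'a \<Rightarrow> real"
  assumes f[measurable]: "f \<in> borel_measurable M" and b: "\<And>x. \<bar>f x\<bar> \<le> b"
  shows "(\<integral>\<^sup>+y. ennreal ((a + (f y - expectation f))\<^sup>2) \<partial>M) \<le> ennreal (a\<^sup>2) + ennreal (4 * b\<^sup>2)"
proof -
  define c where "c = expectation f"
  have f_int: "integrable M f"
    by (rule integrable_const_bound[of _ b]) (use b in auto)
  have cb: "\<bar>c\<bar> \<le> b"
  proof -
    have "f x \<le> b" "- b \<le> f x" for x using b[of x] by linarith+
    then show ?thesis
      unfolding c_def using integral_le_const[OF f_int, of b] integral_ge_const[OF f_int, of "- b"]
      by (simp add: abs_le_iff)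
  qed
  have d: "\<bar>f y - c\<bar> \<le> 2 * b" for y using b[of y] cb by linarith
  have d2: "(f y - c)\<^sup>2 \<le> 4 * b\<^sup>2" for y
    using power_mono[OF d, of y 2] by (simp add: power_mult_distrib)
  have sq_int: "integrable M (\<lambda>y. (f y - c)\<^sup>2)"
    by (rule integrable_const_bound[of _ "4 * b\<^sup>2"]) (use d2 in auto)
  have i: "integrable M (\<lambda>y. (a + (f y - c))\<^sup>2)"
    unfolding power2_sum using f_int sq_int by auto
  have "(\<integral>\<^sup>+y. ennreal ((a + (f y - c))\<^sup>2) \<partial>M) = ennreal (\<integral>y. (a + (f y - c))\<^sup>2 \<partial>M)"
    using i by (intro nn_integral_eq_integral) auto
  also have "(\<integral>y. (a + (f y - c))\<^sup>2 \<partial>M) = (\<integral>y. a\<^sup>2 + ((f y - c)\<^sup>2 + 2 * a * (f y - c)) \<partial>M)"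
    by (intro Bochner_Integration.integral_cong refl) (simp add: power2_eq_square algebra_simps)
  also have "\<dots> = a\<^sup>2 + ((\<integral>y. (f y - c)\<^sup>2 \<partial>M) + 2 * a * (expectation f - c))"
    using f_int sq_int by (simp add: prob_space)
  also have "\<dots> \<le> a\<^sup>2 + 4 * b\<^sup>2"
    using integral_le_const[OF sq_int, of "4 * b\<^sup>2"] d2 by (simp add: c_def)
  finally show ?thesis unfolding c_def[symmetric] by (simp add: ennreal_plus[symmetric] ennreal_leI del: ennreal_plus)
qed

text \<open>
  The martingale that compares the values of \<open>f\<close> along the path with their conditional
  expectations.
\<close>

definition innovation_sum ::
    "(nat \<Rightarrow> (nat \<Rightarrow> 'a::topological_space) \<Rightarrow> 'a measure) \<Rightarrow> ('a \<Rightarrow> real) \<Rightarrow> nat \<Rightarrow> (nat \<Rightarrow> 'a) \<Rightarrow> real" where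
  "innovation_sum \<kappa> f n x = (\<Sum>k<n. f (x k) - (\<integral>y. f y \<partial>\<kappa> k (restrict x {0..<k})))"

lemma measurable_innovation_sum:
  assumes K: "\<And>k. \<kappa> k \<in> power_space k \<rightarrow>\<^sub>M prob_algebra borel" and f: "f \<in> borel_measurable borel"
  shows "innovation_sum \<kappa> f n \<in> borel_measurable (power_space n)"
  unfolding innovation_sum_def
proof (intro borel_measurable_sum borel_measurable_diff)
  fix k assume "k \<in> {..<n}"
  then have k: "k < n" by simp
  show "(\<lambda>x. f (x k)) \<in> borel_measurable (power_space n)"
    using k by (intro measurable_compose[OF measurable_component_singleton[of k "{0..<n}"] f]) auto
  show "(\<lambda>x. \<integral>y. f y \<partial>\<kappa> k (restrict x {0..<k})) \<in> borel_measurable (power_space n)"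
    using k by (intro measurable_compose[OF measurable_compose[OF measurable_restrict_subset
      measurable_prob_algebraD[OF K]] integral_measurable_subprob_algebra[OF f]]) auto
qed

lemma innovation_sum_snoc:
  assumes "x \<in> space (power_space n)"
  shows "innovation_sum \<kappa> f (Suc n) (x(n := y)) = innovation_sum \<kappa> f n x + (f y - (\<integral>y. f y \<partial>\<kappa> n x))"
proof -
  have "restrict (x(n := y)) {0..<n} = x"
    using assms by (auto simp: space_PiM PiE_def extensional_def fun_eq_iff restrict_def)
  moreover have "restrict (x(n := y)) {0..<k} = restrict x {0..<k}" if "k < n" for k
    using that by (auto simp: restrict_def)
  ultimately show ?thesis unfolding innovation_sum_def by simp
qed

lemma innovation_sum_second_moment:
  fixes f :: "'a::topological_space \<Rightarrow> real"
  assumes K: "\<And>k. \<kappa> k \<in> power_space k \<rightarrow>\<^sub>M prob_algebra borel"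
    and f: "f \<in> borel_measurable borel" and b: "\<And>x. \<bar>f x\<bar> \<le> b"
  shows "(\<integral>\<^sup>+x. ennreal ((innovation_sum \<kappa> f n x)\<^sup>2) \<partial>kernel_product \<kappa> n) \<le> ennreal (real n * (4 * b\<^sup>2))"
proof (induction n)
  case 0
  then show ?case by (simp add: innovation_sum_def)
next
  case (Suc n)
  let ?P = "kernel_product \<kappa> n"
  have p: "?P \<in> space (prob_algebra (power_space n))" by (rule kernel_product_in_prob_algebra[OF K])
  interpret P: prob_space ?P using p by (simp add: space_prob_algebra)
  have s: "sets ?P = sets (power_space n)" using p by (simp add: space_prob_algebra)
  have m: "(\<lambda>x. ennreal ((innovation_sum \<kappa> f n x)\<^sup>2)) \<in> borel_measurable (power_space n)" for n
    using measurable_innovation_sum[OF K f, of n] by measurable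
  have "(\<integral>\<^sup>+x. ennreal ((innovation_sum \<kappa> f (Suc n) x)\<^sup>2) \<partial>kernel_product \<kappa> (Suc n))
    = (\<integral>\<^sup>+x. \<integral>\<^sup>+z. ennreal ((innovation_sum \<kappa> f (Suc n) z)\<^sup>2) \<partial>distr (\<kappa> n x) (power_space (Suc n)) (\<lambda>y. x(n := y)) \<partial>?P)"
    unfolding kernel_product_Suc[OF K] using measurable_prob_algebraD[OF measurable_snoc_kernel[OF K], of n]
    by (intro nn_integral_bind[OF m]) (simp add: measurable_cong_sets[OF s refl])
  also have "\<dots> \<le> (\<integral>\<^sup>+x. ennreal ((innovation_sum \<kappa> f n x)\<^sup>2) + ennreal (4 * b\<^sup>2) \<partial>?P)"
  proof (rule nn_integral_mono)
    fix x assume "x \<in> space ?P"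
    then have x: "x \<in> space (power_space n)" using sets_eq_imp_space_eq[OF s] by simp
    then have kx: "\<kappa> n x \<in> probs" using measurable_space[OF K] by simp
    then interpret k: prob_space "\<kappa> n x" by (simp add: space_prob_algebra)
    have sk: "sets (\<kappa> n x) = sets borel" using kx by (simp add: space_prob_algebra)
    have "(\<lambda>y. x(n := y)) \<in> \<kappa> n x \<rightarrow>\<^sub>M power_space (Suc n)"
      using measurable_compose[OF measurable_Pair1'[OF x] measurable_snoc]
      by (simp add: measurable_cong_sets[OF sk refl])
    then have "(\<integral>\<^sup>+z. ennreal ((innovation_sum \<kappa> f (Suc n) z)\<^sup>2) \<partial>distr (\<kappa> n x) (power_space (Suc n)) (\<lambda>y. x(n := y)))
        = (\<integral>\<^sup>+y. ennreal ((innovation_sum \<kappa> f n x + (f y - (\<integral>y. f y \<partial>\<kappa> n x)))\<^sup>2) \<partial>\<kappa> n x)"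
      by (subst nn_integral_distr) (use m in \<open>simp_all add: innovation_sum_snoc[OF x]\<close>)
    also have "\<dots> \<le> ennreal ((innovation_sum \<kappa> f n x)\<^sup>2) + ennreal (4 * b\<^sup>2)"
      using f b by (intro k.nn_integral_square_centered_le) (simp_all add: measurable_cong_sets[OF sk refl])
    finally show "(\<integral>\<^sup>+z. ennreal ((innovation_sum \<kappa> f (Suc n) z)\<^sup>2) \<partial>distr (\<kappa> n x) (power_space (Suc n)) (\<lambda>y. x(n := y)))
        \<le> ennreal ((innovation_sum \<kappa> f n x)\<^sup>2) + ennreal (4 * b\<^sup>2)" .
  qed
  also have "\<dots> = (\<integral>\<^sup>+x. ennreal ((innovation_sum \<kappa> f n x)\<^sup>2) \<partial>?P) + ennreal (4 * b\<^sup>2)"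
    using m[of n] P.emeasure_space_1 by (subst nn_integral_add) (simp_all add: measurable_cong_sets[OF s refl])
  also have "\<dots> \<le> ennreal (real n * (4 * b\<^sup>2)) + ennreal (4 * b\<^sup>2)"
    using Suc by (intro add_right_mono)
  also have "\<dots> = ennreal (real (Suc n) * (4 * b\<^sup>2))"
    by (subst ennreal_plus[symmetric]) (auto simp: algebra_simps)
  finally show ?case .
qed

lemma innovation_sum_tail:
  fixes f :: "'a::topological_space \<Rightarrow> real"
  assumes K: "\<And>k. \<kappa> k \<in> power_space k \<rightarrow>\<^sub>M prob_algebra borel"
    and f: "f \<in> borel_measurable borel" and b: "\<And>x. \<bar>f x\<bar> \<le> b" and "\<delta> > 0" "n > 0"
  shows "measure (kernel_product \<kappa> n) {x \<in> space (power_space n). \<bar>innovation_sum \<kappa> f n x\<bar> \<ge> real n * \<delta>}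
    \<le> 4 * b\<^sup>2 / (real n * \<delta>\<^sup>2)"
proof -
  let ?P = "kernel_product \<kappa> n"
  let ?A = "{x \<in> space (power_space n). \<bar>innovation_sum \<kappa> f n x\<bar> \<ge> real n * \<delta>}"
  have p: "?P \<in> space (prob_algebra (power_space n))" by (rule kernel_product_in_prob_algebra[OF K])
  interpret P: prob_space ?P using p by (simp add: space_prob_algebra)
  have s[measurable_cong]: "sets ?P = sets (power_space n)" using p by (simp add: space_prob_algebra)
  note [measurable] = measurable_innovation_sum[OF K f, of n]
  have A[measurable]: "?A \<in> sets ?P" unfolding s by measurable
  have "ennreal ((real n * \<delta>)\<^sup>2) * emeasure ?P ?A = (\<integral>\<^sup>+x. ennreal ((real n * \<delta>)\<^sup>2) * indicator ?A x \<partial>?P)"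
    by (simp add: nn_integral_cmult_indicator)
  also have "\<dots> \<le> (\<integral>\<^sup>+x. ennreal ((innovation_sum \<kappa> f n x)\<^sup>2) \<partial>?P)"
  proof (rule nn_integral_mono)
    fix x
    have "(real n * \<delta>)\<^sup>2 \<le> (innovation_sum \<kappa> f n x)\<^sup>2" if "x \<in> ?A"
      using that assms(4) by (subst power2_abs[of "innovation_sum \<kappa> f n x", symmetric], intro power_mono) auto
    then show "ennreal ((real n * \<delta>)\<^sup>2) * indicator ?A x \<le> ennreal ((innovation_sum \<kappa> f n x)\<^sup>2)"
      by (cases "x \<in> ?A") (simp_all add: ennreal_leI)
  qed
  also have "\<dots> \<le> ennreal (real n * (4 * b\<^sup>2))" by (rule innovation_sum_second_moment[OF K f b])
  finally have "(real n * \<delta>)\<^sup>2 * measure ?P ?A \<le> real n * (4 * b\<^sup>2)"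
    by (simp add: P.emeasure_eq_measure ennreal_mult[symmetric])
  then show ?thesis
    using assms(4,5) by (simp add: power2_eq_square field_simps)
qed

section \<open>The two bounds and the limit\<close>

text \<open>
  The nonnegative integral of an arbitrary function is the supremum over the simple functions
  below it, so it is monotone on all functions, measurable or not. This is how \<open>\<alpha>\<close>, of which
  only convexity and compact sublevel sets are known, is compared with a measurable minorant.
\<close>

lemma ereal_integral_ge:
  assumes "integrable \<nu> g" and le: "\<And>x. x \<in> space \<nu> \<Longrightarrow> ereal (g x) \<le> h x"
  shows "ereal (\<integral>x. g x \<partial>\<nu>) \<le> ereal_integral \<nu> h"
proof -
  have fin: "(\<integral>\<^sup>+x. ennreal (g x) \<partial>\<nu>) \<noteq> \<infinity>" "(\<integral>\<^sup>+x. ennreal (- g x) \<partial>\<nu>) \<noteq> \<infinity>"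
    using assms(1) by (auto simp: real_integrable_def)
  have "ereal (\<integral>x. g x \<partial>\<nu>) = enn2ereal (\<integral>\<^sup>+x. ennreal (g x) \<partial>\<nu>) - enn2ereal (\<integral>\<^sup>+x. ennreal (- g x) \<partial>\<nu>)"
    unfolding real_lebesgue_integral_def[OF assms(1)]
    using fin by (cases "\<integral>\<^sup>+x. ennreal (g x) \<partial>\<nu>"; cases "\<integral>\<^sup>+x. ennreal (- g x) \<partial>\<nu>") (auto simp: enn2ereal_ennreal)
  also have "\<dots> \<le> ereal_integral \<nu> h"
    unfolding ereal_integral_def
  proof (intro ereal_minus_mono)
    have "(\<integral>\<^sup>+x. ennreal (g x) \<partial>\<nu>) \<le> (\<integral>\<^sup>+x. e2ennreal (h x) \<partial>\<nu>)"
      using le by (intro nn_integral_mono) (metis e2ennreal_ereal e2ennreal_mono)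
    then show "enn2ereal (\<integral>\<^sup>+x. ennreal (g x) \<partial>\<nu>) \<le> enn2ereal (\<integral>\<^sup>+x. e2ennreal (h x) \<partial>\<nu>)"
      by (simp add: less_eq_ennreal.rep_eq)
    have "e2ennreal (- h x) \<le> ennreal (- g x)" if "x \<in> space \<nu>" for x
    proof -
      have "- h x \<le> ereal (- g x)" using le[OF that] by (metis ereal_minus_le_minus uminus_ereal.simps(1))
      then show ?thesis by (metis e2ennreal_ereal e2ennreal_mono)
    qed
    then have "(\<integral>\<^sup>+x. e2ennreal (- h x) \<partial>\<nu>) \<le> (\<integral>\<^sup>+x. ennreal (- g x) \<partial>\<nu>)"
      by (intro nn_integral_mono)
    then show "enn2ereal (\<integral>\<^sup>+x. e2ennreal (- h x) \<partial>\<nu>) \<le> enn2ereal (\<integral>\<^sup>+x. ennreal (- g x) \<partial>\<nu>)"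
      by (simp add: less_eq_ennreal.rep_eq)
  qed
  finally show ?thesis .
qed

lemma (in prob_space) ereal_integral_AE_const:
  assumes "AE x in M. h x = ereal c"
  shows "ereal_integral M h = ereal c"
proof -
  have "(\<integral>\<^sup>+x. e2ennreal (h x) \<partial>M) = (\<integral>\<^sup>+x. ennreal c \<partial>M)"
    using assms by (intro nn_integral_cong_AE) (auto elim!: eventually_mono)
  moreover have "(\<integral>\<^sup>+x. e2ennreal (- h x) \<partial>M) = (\<integral>\<^sup>+x. ennreal (- c) \<partial>M)"
    using assms by (intro nn_integral_cong_AE) (auto elim!: eventually_mono)
  ultimately show ?thesis
    unfolding ereal_integral_def using emeasure_space_1
    by (cases "c \<ge> 0") (auto simp: enn2ereal_ennreal ennreal_neg zero_ereal_def zero_ennreal.rep_eq)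
qed

definition deviation_set ::
    "(nat \<Rightarrow> (nat \<Rightarrow> 'a::topological_space) \<Rightarrow> 'a measure) \<Rightarrow> ('a \<Rightarrow> real) set \<Rightarrow> real \<Rightarrow> nat \<Rightarrow> (nat \<Rightarrow> 'a) set" where
  "deviation_set \<kappa> J \<delta> n = {x \<in> space (power_space n). \<exists>f\<in>J. real n * \<delta> \<le> \<bar>innovation_sum \<kappa> f n x\<bar>}"

lemma sets_deviation_set:
  assumes K: "\<And>k. \<kappa> k \<in> power_space k \<rightarrow>\<^sub>M prob_algebra borel"
    and J: "finite J" "\<And>f. f \<in> J \<Longrightarrow> f \<in> borel_measurable borel"
  shows "deviation_set \<kappa> J \<delta> n \<in> sets (power_space n)"
proof -
  have "{x \<in> space (power_space n). real n * \<delta> \<le> \<bar>innovation_sum \<kappa> f n x\<bar>} \<in> sets (power_space n)"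
    if "f \<in> J" for f
    using measurable_innovation_sum[OF K J(2)[OF that], of n] by measurable
  moreover have "deviation_set \<kappa> J \<delta> n
      = (\<Union>f\<in>J. {x \<in> space (power_space n). real n * \<delta> \<le> \<bar>innovation_sum \<kappa> f n x\<bar>})"
    unfolding deviation_set_def by auto
  ultimately show ?thesis using J(1) by (simp add: sets.finite_UN)
qed

lemma measure_deviation_set_le:
  assumes K: "\<And>k. \<kappa> k \<in> power_space k \<rightarrow>\<^sub>M prob_algebra borel"
    and J: "finite J" "\<And>f. f \<in> J \<Longrightarrow> f \<in> borel_measurable borel" "\<And>f x. f \<in> J \<Longrightarrow> \<bar>f x\<bar> \<le> b"
    and \<delta>: "\<delta> > 0" and n: "n > 0"
  shows "real n * measure (kernel_product \<kappa> n) (deviation_set \<kappa> J \<delta> n) \<le> real (card J) * (4 * b\<^sup>2 / \<delta>\<^sup>2)"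
proof -
  let ?P = "kernel_product \<kappa> n"
  let ?A = "\<lambda>f. deviation_set \<kappa> {f} \<delta> n"
  have p: "?P \<in> space (prob_algebra (power_space n))" by (rule kernel_product_in_prob_algebra[OF K])
  interpret P: prob_space ?P using p by (simp add: space_prob_algebra)
  have s: "sets ?P = sets (power_space n)" using p by (simp add: space_prob_algebra)
  have A: "?A f \<in> sets ?P" if "f \<in> J" for f
    unfolding s using that J(2) by (intro sets_deviation_set[OF K]) auto
  have "deviation_set \<kappa> J \<delta> n = (\<Union>f\<in>J. ?A f)" unfolding deviation_set_def by auto
  then have "measure ?P (deviation_set \<kappa> J \<delta> n) \<le> (\<Sum>f\<in>J. measure ?P (?A f))"
    using A J(1) P.finite_measure_subadditive_finite[of J ?A] by auto
  also have "\<dots> \<le> (\<Sum>f\<in>J. 4 * b\<^sup>2 / (real n * \<delta>\<^sup>2))"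
    using innovation_sum_tail[OF K J(2) J(3) \<delta> n] by (intro sum_mono) (simp add: deviation_set_def)
  finally have "real n * measure ?P (deviation_set \<kappa> J \<delta> n) \<le> real n * (\<Sum>f\<in>J. 4 * b\<^sup>2 / (real n * \<delta>\<^sup>2))"
    by (rule mult_left_mono) simp
  also have "\<dots> = real (card J) * (4 * b\<^sup>2 / \<delta>\<^sup>2)" using n by simp
  finally show ?thesis .
qed

text \<open>
  Off the deviation event, a measure whose integral of \<open>f\<close> is the average of the
  conditional integrals is \<open>\<delta>\<close>-close to \<open>L\<^sub>n\<close> when tested by \<open>f\<close>. The hypothesis covers both
  the mean of the kernels and, for a product law, the common factor.
\<close>

lemma near_empirical_measure:
  assumes n: "n > 0" and f: "f \<in> borel_measurable borel" "bounded (range f)" and "f \<in> J"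
    and x: "x \<in> space (power_space n)" "x \<notin> deviation_set \<kappa> J \<delta> n"
    and \<mu>: "real n * (\<integral>y. f y \<partial>\<mu>) = (\<Sum>k<n. \<integral>y. f y \<partial>\<kappa> k (restrict x {0..<k}))"
  shows "\<bar>(\<integral>y. f y \<partial>\<mu>) - (\<integral>y. f y \<partial>empirical_measure n x)\<bar> < \<delta>"
proof -
  have "innovation_sum \<kappa> f n x = real n * ((\<integral>y. f y \<partial>empirical_measure n x) - (\<integral>y. f y \<partial>\<mu>))"
    using \<mu> n by (simp add: innovation_sum_def sum_subtractf integral_empirical_measure[OF n f] right_diff_distrib)
  moreover have "\<bar>innovation_sum \<kappa> f n x\<bar> < real n * \<delta>"
    using x assms(4) unfolding deviation_set_def by (auto simp: not_le)
  ultimately show ?thesis using n by (simp add: abs_mult abs_minus_commute)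
qed

lemma common_bound:
  assumes "finite J" "\<And>f. f \<in> J \<Longrightarrow> bounded (range f)"
  obtains b :: real where "\<And>f x. f \<in> J \<Longrightarrow> \<bar>f x :: real\<bar> \<le> b"
proof -
  have "bounded (\<Union>f\<in>J. range f)" using assms by (intro bounded_UN) auto
  then obtain b where "\<forall>y\<in>(\<Union>f\<in>J. range f). \<bar>y\<bar> \<le> b" by (auto simp: bounded_real)
  then show ?thesis by (intro that[of b]) auto
qed

text \<open>
  The level \<open>B - s\<close> of the compact set is chosen so that above it the crude bound
  \<open>F \<le> B\<close> already gives \<open>F - \<alpha> \<le> s\<close>. The constant \<open>D\<close> is \<open>2 B\<close>, the largest
  possible error on the deviation event, times \<open>n\<close> times the bound for its probability.
\<close>

lemma rho_n_le:
  fixes \<alpha> :: "'a::polish_space measure \<Rightarrow> ereal" and F :: "'a measure \<Rightarrow> real"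
  assumes ninf: "\<And>\<nu>. \<nu> \<in> probs \<Longrightarrow> \<alpha> \<nu> \<noteq> -\<infinity>" and conv: "convex_on_probs \<alpha>"
    and comp: "\<And>c::real. compactin weak_topology {\<nu> \<in> probs. \<alpha> \<nu> \<le> ereal c}"
    and F: "continuous_map weak_topology euclideanreal F"
    and B: "\<And>\<nu>. \<nu> \<in> probs \<Longrightarrow> \<bar>F \<nu>\<bar> \<le> B"
    and s: "\<And>\<nu>. \<nu> \<in> probs \<Longrightarrow> ereal (F \<nu>) - \<alpha> \<nu> \<le> ereal s" and \<epsilon>: "\<epsilon> > 0"
  obtains D where "\<And>n. n > 0 \<Longrightarrow>
    rho_n \<alpha> n (\<lambda>x. real n * F (empirical_measure n x)) \<le> ereal (real n * (s + \<epsilon>) + D)"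
proof -
  define K where "K = {\<nu> \<in> probs. \<alpha> \<nu> \<le> ereal (B - s)}"
  obtain J :: "('a \<Rightarrow> real) set" and \<delta> where
    J: "finite J" "\<And>f. f \<in> J \<Longrightarrow> continuous_on UNIV f \<and> bounded (range f)" and \<delta>: "\<delta> > 0"
    and near: "\<And>\<mu> \<eta>. \<mu> \<in> K \<Longrightarrow> \<eta> \<in> probs \<Longrightarrow>
      (\<And>f. f \<in> J \<Longrightarrow> \<bar>(\<integral>x. f x \<partial>\<mu>) - (\<integral>x. f x \<partial>\<eta>)\<bar> < \<delta>) \<Longrightarrow> \<bar>F \<mu> - F \<eta>\<bar> < \<epsilon>"
    using weak_uniform_continuity_near_compact[OF F comp[of "B - s"] \<epsilon>] unfolding K_def by blast
  have Jm: "f \<in> borel_measurable borel" if "f \<in> J" for f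
    using J(2)[OF that] by (auto intro: borel_measurable_continuous_onI)
  obtain b where b: "\<And>f x. f \<in> J \<Longrightarrow> \<bar>f x\<bar> \<le> b" using common_bound[OF J(1)] J(2) by metis
  have "return borel (undefined :: 'a) \<in> probs" by (simp add: space_prob_algebra prob_space_return)
  from B[OF this] have B0: "B \<ge> 0" by linarith
  define D where "D = 2 * B * (real (card J) * (4 * b\<^sup>2 / \<delta>\<^sup>2))"
  show ?thesis
  proof (rule that)
    fix n :: nat assume n: "n > 0"
    have "ereal (\<integral>x. real n * F (empirical_measure n x) \<partial>\<nu>) - alpha_n \<alpha> n \<nu> \<le> ereal (real n * (s + \<epsilon>) + D)"
      if \<nu>: "\<nu> \<in> space (prob_algebra (power_space n))" for \<nu>
    proof -
      define \<kappa> where "\<kappa> = (SOME \<kappa>. disintegration n \<nu> \<kappa>)"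
      have dis: "disintegration n \<nu> \<kappa>"
        unfolding \<kappa>_def using disintegration_exists[OF \<nu>] by (rule someI_ex)
      have K: "\<kappa> k \<in> power_space k \<rightarrow>\<^sub>M prob_algebra borel" for k
        using dis by (simp add: disintegration_def)
      have \<nu>_eq: "\<nu> = kernel_product \<kappa> n" using dis by (simp add: disintegration_def)
      interpret prob_space \<nu> using \<nu> by (simp add: space_prob_algebra)
      have sets: "sets \<nu> = sets (power_space n)" using \<nu> by (simp add: space_prob_algebra)
      let ?bad = "deviation_set \<kappa> J \<delta> n"
      have bad: "?bad \<in> sets \<nu>"
        unfolding sets using J(1) Jm by (rule sets_deviation_set[OF K])
      have Fm: "(\<lambda>x. F (empirical_measure n x)) \<in> borel_measurable \<nu>"
        using borel_measurable_comp_empirical_measure[OF F n] by (simp add: measurable_cong_sets[OF sets refl])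
      have Fi: "integrable \<nu> (\<lambda>x. F (empirical_measure n x))"
        using Fm B[OF empirical_measure_in_probs[OF n]] by (intro integrable_const_bound[of _ B]) auto
      \<comment> \<open>A bounded measurable minorant of the sum of the \<open>\<alpha> (\<kappa> k)\<close>.\<close>
      define g where "g x = real n * (F (empirical_measure n x) - s - \<epsilon> - 2 * B * indicat_real ?bad x)" for x
      have gi: "integrable \<nu> g" unfolding g_def using Fi bad
        by (intro integrable_mult_right Bochner_Integration.integrable_diff integrable_const integrable_real_indicator)
          (auto simp: emeasure_eq_measure)
      have "(\<integral>x. g x \<partial>\<nu>) = real n * ((\<integral>x. F (empirical_measure n x) \<partial>\<nu>) - s - \<epsilon> - 2 * B * measure \<nu> ?bad)"
        unfolding g_def using Fi bad by (simp add: prob_space emeasure_eq_measure)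
      moreover have "real n * measure \<nu> ?bad \<le> real (card J) * (4 * b\<^sup>2 / \<delta>\<^sup>2)"
        unfolding \<nu>_eq using J(1) Jm b \<delta> n by (rule measure_deviation_set_le[OF K])
      then have "2 * B * (real n * measure \<nu> ?bad) \<le> D"
        unfolding D_def using B0 by (intro mult_left_mono) auto
      ultimately have gint: "real n * (\<integral>x. F (empirical_measure n x) \<partial>\<nu>) - (real n * (s + \<epsilon>) + D) \<le> (\<integral>x. g x \<partial>\<nu>)"
        by (simp add: algebra_simps)
      have "ereal (\<integral>x. g x \<partial>\<nu>) \<le> alpha_n \<alpha> n \<nu>"
        unfolding alpha_n_def Let_def \<kappa>_def[symmetric]
      proof (rule ereal_integral_ge[OF gi])
        fix x assume "x \<in> space \<nu>"
        then have x: "x \<in> space (power_space n)" using sets_eq_imp_space_eq[OF sets] by simp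
        define m where "m k = \<kappa> k (restrict x {0..<k})" for k
        have m: "m k \<in> probs" for k
          unfolding m_def by (rule measurable_space[OF K]) (simp add: space_PiM)
        let ?A = "mean_measure m n" and ?L = "empirical_measure n x"
        have A: "?A \<in> probs" by (rule mean_measure_in_probs[OF m])
        have L: "?L \<in> probs" by (rule empirical_measure_in_probs[OF n])
        have "ereal (g x) \<le> ereal (real n) * \<alpha> ?A"
        proof (cases "\<alpha> ?A")
          case (real a)
          have sa: "F ?A - a \<le> s" using s[OF A] real by simp
          have "F ?L - s - \<epsilon> - 2 * B * indicat_real ?bad x \<le> a"
          proof (cases "a \<le> B - s")
            case False
            then show ?thesis using B[OF L] B0 \<epsilon> by (auto simp: indicator_def)
          next
            case True
            show ?thesis
            proof (cases "x \<in> ?bad")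
              case True
              then show ?thesis using B[OF L] B[OF A] sa \<epsilon> by simp
            next
              case False
              have "\<bar>F ?A - F ?L\<bar> < \<epsilon>"
              proof (rule near[OF _ L])
                show "?A \<in> K" unfolding K_def using A real \<open>a \<le> B - s\<close> by simp
                fix f assume f: "f \<in> J"
                have bf: "bounded (range f)" using J(2)[OF f] by simp
                have "real n * (\<integral>y. f y \<partial>?A) = (\<Sum>k<n. \<integral>y. f y \<partial>m k)"
                  by (rule integral_mean_measure[OF m Jm[OF f] bf])
                then show "\<bar>(\<integral>y. f y \<partial>?A) - (\<integral>y. f y \<partial>?L)\<bar> < \<delta>"
                  unfolding m_def by (rule near_empirical_measure[OF n Jm[OF f] bf f x False])
              qed
              then show ?thesis using sa False by simp
            qed
          qed
          then show ?thesis unfolding g_def real using n by simp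
        qed (use ninf[OF A] n in auto)
        also have "\<dots> \<le> (\<Sum>k<n. \<alpha> (m k))" by (rule convex_mean_measure[OF conv m ninf])
        finally show "ereal (g x) \<le> (\<Sum>k<n. \<alpha> (\<kappa> k (restrict x {0..<k})))" unfolding m_def .
      qed
      then have "ereal (\<integral>x. real n * F (empirical_measure n x) \<partial>\<nu>) - alpha_n \<alpha> n \<nu>
          \<le> ereal (\<integral>x. real n * F (empirical_measure n x) \<partial>\<nu>) - ereal (\<integral>x. g x \<partial>\<nu>)"
        by (intro ereal_minus_mono) auto
      also have "\<dots> \<le> ereal (real n * (s + \<epsilon>) + D)" using gint by simp
      finally show ?thesis .
    qed
    then show "rho_n \<alpha> n (\<lambda>x. real n * F (empirical_measure n x)) \<le> ereal (real n * (s + \<epsilon>) + D)"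
      unfolding rho_n_def by (rule SUP_least)
  qed
qed

text \<open>
  The law that is inserted into the supremum is the \<open>n\<close>-fold product of \<open>\<mu>\<close>, written with
  constant kernels.
\<close>

lemma rho_n_ge:
  fixes \<alpha> :: "'a::polish_space measure \<Rightarrow> ereal" and F :: "'a measure \<Rightarrow> real"
  assumes F: "continuous_map weak_topology euclideanreal F"
    and B: "\<And>\<nu>. \<nu> \<in> probs \<Longrightarrow> \<bar>F \<nu>\<bar> \<le> B"
    and \<mu>: "\<mu> \<in> probs" "\<alpha> \<mu> = ereal a" and \<epsilon>: "\<epsilon> > 0"
  obtains D where "\<And>n. n > 0 \<Longrightarrow>
    ereal (real n * (F \<mu> - a - \<epsilon>) - D) \<le> rho_n \<alpha> n (\<lambda>x. real n * F (empirical_measure n x))"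
proof -
  have "compactin weak_topology {\<mu>}" using \<mu>(1) by simp
  from weak_uniform_continuity_near_compact[OF F this \<epsilon>]
  obtain J :: "('a \<Rightarrow> real) set" and \<delta> where
    J: "finite J" "\<And>f. f \<in> J \<Longrightarrow> continuous_on UNIV f \<and> bounded (range f)" and \<delta>: "\<delta> > 0"
    and near: "\<And>\<eta>. \<eta> \<in> probs \<Longrightarrow>
      (\<And>f. f \<in> J \<Longrightarrow> \<bar>(\<integral>x. f x \<partial>\<mu>) - (\<integral>x. f x \<partial>\<eta>)\<bar> < \<delta>) \<Longrightarrow> \<bar>F \<mu> - F \<eta>\<bar> < \<epsilon>"
    by (metis insertI1)
  have Jm: "f \<in> borel_measurable borel" if "f \<in> J" for f
    using J(2)[OF that] by (auto intro: borel_measurable_continuous_onI)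
  obtain b where b: "\<And>f x. f \<in> J \<Longrightarrow> \<bar>f x\<bar> \<le> b" using common_bound[OF J(1)] J(2) by metis
  from B[OF \<mu>(1)] have B0: "B \<ge> 0" by linarith
  define D where "D = 2 * B * (real (card J) * (4 * b\<^sup>2 / \<delta>\<^sup>2))"
  define \<kappa> where "\<kappa> = (\<lambda>(k::nat) (x :: nat \<Rightarrow> 'a). \<mu>)"
  have K: "\<kappa> k \<in> power_space k \<rightarrow>\<^sub>M prob_algebra borel" for k
    unfolding \<kappa>_def using \<mu>(1) by (rule measurable_const)
  show ?thesis
  proof (rule that)
    fix n :: nat assume n: "n > 0"
    define \<nu> where "\<nu> = kernel_product \<kappa> n"
    have \<nu>: "\<nu> \<in> space (prob_algebra (power_space n))"
      unfolding \<nu>_def by (rule kernel_product_in_prob_algebra[OF K])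
    interpret prob_space \<nu> using \<nu> by (simp add: space_prob_algebra)
    have sets: "sets \<nu> = sets (power_space n)" using \<nu> by (simp add: space_prob_algebra)
    have dis: "disintegration n \<nu> \<kappa>" using K by (simp add: disintegration_def \<nu>_def)
    have "alpha_n \<alpha> n \<nu> = ereal (real n * a)"
    proof -
      define \<kappa>' where "\<kappa>' = (SOME \<kappa>. disintegration n \<nu> \<kappa>)"
      have "disintegration n \<nu> \<kappa>'" unfolding \<kappa>'_def using someI[of "disintegration n \<nu>", OF dis] .
      from disintegration_unique_AE[OF this dis]
      have "AE x in \<nu>. \<forall>k\<in>{..<n}. \<kappa>' k (restrict x {0..<k}) = \<mu>"
        unfolding \<kappa>_def by (subst AE_ball_countable) auto
      then have "AE x in \<nu>. (\<Sum>k<n. \<alpha> (\<kappa>' k (restrict x {0..<k}))) = ereal (real n * a)"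
        by eventually_elim (simp add: \<mu>(2))
      then show ?thesis
        unfolding alpha_n_def Let_def \<kappa>'_def[symmetric] by (rule ereal_integral_AE_const)
    qed
    moreover have "real n * (F \<mu> - \<epsilon>) - D \<le> (\<integral>x. real n * F (empirical_measure n x) \<partial>\<nu>)"
    proof -
      let ?bad = "deviation_set \<kappa> J \<delta> n"
      have bad: "?bad \<in> sets \<nu>"
        unfolding sets using J(1) Jm by (rule sets_deviation_set[OF K])
      have "(\<lambda>x. F (empirical_measure n x)) \<in> borel_measurable \<nu>"
        using borel_measurable_comp_empirical_measure[OF F n] by (simp add: measurable_cong_sets[OF sets refl])
      then have Fi: "integrable \<nu> (\<lambda>x. F (empirical_measure n x))"
        using B[OF empirical_measure_in_probs[OF n]] by (intro integrable_const_bound[of _ B]) auto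
      define g where "g x = F \<mu> - \<epsilon> - 2 * B * indicat_real ?bad x" for x
      have gi: "integrable \<nu> g" unfolding g_def using bad
        by (intro integrable_mult_right Bochner_Integration.integrable_diff integrable_const integrable_real_indicator)
          (auto simp: emeasure_eq_measure)
      have "g x \<le> F (empirical_measure n x)" if "x \<in> space \<nu>" for x
      proof (cases "x \<in> ?bad")
        case True
        then show ?thesis
          using B[OF empirical_measure_in_probs[OF n], of x] B[OF \<mu>(1)] \<epsilon> by (simp add: g_def)
      next
        case False
        have x: "x \<in> space (power_space n)" using that sets_eq_imp_space_eq[OF sets] by simp
        have "\<bar>F \<mu> - F (empirical_measure n x)\<bar> < \<epsilon>"
        proof (rule near[OF empirical_measure_in_probs[OF n]])
          fix f assume f: "f \<in> J"
          then show "\<bar>(\<integral>y. f y \<partial>\<mu>) - (\<integral>y. f y \<partial>empirical_measure n x)\<bar> < \<delta>"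
            using J(2)[OF f] by (intro near_empirical_measure[OF n Jm[OF f] _ f x False]) (auto simp: \<kappa>_def)
        qed
        then show ?thesis using False by (simp add: g_def)
      qed
      then have "(\<integral>x. g x \<partial>\<nu>) \<le> (\<integral>x. F (empirical_measure n x) \<partial>\<nu>)"
        using gi Fi by (intro integral_mono)
      moreover have "(\<integral>x. g x \<partial>\<nu>) = F \<mu> - \<epsilon> - 2 * B * measure \<nu> ?bad"
        unfolding g_def using bad by (simp add: prob_space emeasure_eq_measure)
      ultimately have "real n * (F \<mu> - \<epsilon> - 2 * B * measure \<nu> ?bad) \<le> real n * (\<integral>x. F (empirical_measure n x) \<partial>\<nu>)"
        by (intro mult_left_mono) auto
      moreover have "real n * measure \<nu> ?bad \<le> real (card J) * (4 * b\<^sup>2 / \<delta>\<^sup>2)"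
        unfolding \<nu>_def using J(1) Jm b \<delta> n by (rule measure_deviation_set_le[OF K])
      then have "2 * B * (real n * measure \<nu> ?bad) \<le> D"
        unfolding D_def using B0 by (intro mult_left_mono) auto
      ultimately show ?thesis by (simp add: algebra_simps)
    qed
    ultimately have "ereal (real n * (F \<mu> - a - \<epsilon>) - D)
        \<le> ereal (\<integral>x. real n * F (empirical_measure n x) \<partial>\<nu>) - alpha_n \<alpha> n \<nu>"
      by (simp add: algebra_simps)
    also have "\<dots> \<le> rho_n \<alpha> n (\<lambda>x. real n * F (empirical_measure n x))"
      unfolding rho_n_def using \<nu> by (intro SUP_upper)
    finally show "ereal (real n * (F \<mu> - a - \<epsilon>) - D) \<le> rho_n \<alpha> n (\<lambda>x. real n * F (empirical_measure n x))" .
  qed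
qed

theorem theorem1p1:
  fixes \<alpha> :: "'a::polish_space measure \<Rightarrow> ereal"
    and F :: "'a measure \<Rightarrow> real"
  assumes "\<And>\<nu>. \<nu> \<in> probs \<Longrightarrow> \<alpha> \<nu> \<noteq> -\<infinity>"
    and "convex_on_probs \<alpha>"
    and "\<exists>\<nu>\<in>probs. \<alpha> \<nu> \<noteq> \<infinity>"
    and "\<And>c::real. compactin weak_topology {\<nu> \<in> probs. \<alpha> \<nu> \<le> ereal c}"
    and "continuous_map weak_topology euclideanreal F"
    and "bounded (F ` probs)"
  shows "(\<lambda>n. ereal (1 / real n) * rho_n \<alpha> n (\<lambda>x. real n * F (empirical_measure n x)))
    \<longlonglongrightarrow> (SUP \<nu>\<in>probs. ereal (F \<nu>) - \<alpha> \<nu>)"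
proof -
  let ?\<rho> = "\<lambda>n. rho_n \<alpha> n (\<lambda>x. real n * F (empirical_measure n x))"
  let ?S = "SUP \<nu>\<in>probs. ereal (F \<nu>) - \<alpha> \<nu>"
  obtain B where B: "\<And>\<nu>. \<nu> \<in> probs \<Longrightarrow> \<bar>F \<nu>\<bar> \<le> B"
    using assms(6) by (auto simp: bounded_real)
  have scale: "ereal (1 / real n) * ereal (real n * v + D) = ereal (v + D / real n)" if "n > 0" for n v D
    using that by (simp add: field_simps)
  have small: "\<forall>\<^sub>F n in sequentially. D / real n < \<epsilon>" if "\<epsilon> > 0" for D \<epsilon> :: real
    using lim_const_over_n[of D] that by (rule order_tendstoD(2))
  show ?thesis
  proof (rule order_tendstoI)
    fix c assume "c < ?S"
    then obtain \<mu> where \<mu>: "\<mu> \<in> probs" "c < ereal (F \<mu>) - \<alpha> \<mu>" by (auto simp: less_SUP_iff)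
    then obtain a where a: "\<alpha> \<mu> = ereal a" using assms(1)[OF \<mu>(1)] by (cases "\<alpha> \<mu>") auto
    with \<mu>(2) have "c < ereal (F \<mu> - a)" by simp
    then obtain w where w: "c < ereal w" "w < F \<mu> - a" using ereal_dense2 by (metis ereal_less_eq(3) less_ereal.simps(1))
    define \<epsilon> where "\<epsilon> = (F \<mu> - a - w) / 2"
    have \<epsilon>: "\<epsilon> > 0" unfolding \<epsilon>_def using w by simp
    obtain D where D: "\<And>n. n > 0 \<Longrightarrow> ereal (real n * (F \<mu> - a - \<epsilon>) - D) \<le> ?\<rho> n"
      using rho_n_ge[where \<alpha> = \<alpha> and F = F, OF assms(5) B \<mu>(1) a \<epsilon>] by blast
    show "\<forall>\<^sub>F n in sequentially. c < ereal (1 / real n) * ?\<rho> n"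
      using small[OF \<epsilon>, of D] eventually_gt_at_top[of 0]
    proof eventually_elim
      case (elim n)
      have "ereal w < ereal (F \<mu> - a - \<epsilon> + (- D) / real n)"
        using elim by (simp add: \<epsilon>_def field_simps)
      also have "\<dots> = ereal (1 / real n) * ereal (real n * (F \<mu> - a - \<epsilon>) - D)"
        using scale[OF elim(2), of "F \<mu> - a - \<epsilon>" "- D"] by simp
      also have "\<dots> \<le> ereal (1 / real n) * ?\<rho> n"
        using D[OF elim(2)] by (intro ereal_mult_left_mono) auto
      finally show ?case using w(1) by simp
    qed
  next
    fix c assume c: "?S < c"
    obtain \<mu> where \<mu>: "\<mu> \<in> probs" "\<alpha> \<mu> \<noteq> \<infinity>" using assms(3) by auto
    have "ereal (F \<mu>) - \<alpha> \<mu> \<le> ?S" using \<mu>(1) by (intro SUP_upper)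
    moreover have "ereal (F \<mu>) - \<alpha> \<mu> \<noteq> -\<infinity>" using \<mu>(2) by (cases "\<alpha> \<mu>") auto
    ultimately have "?S \<noteq> -\<infinity>" by auto
    with c obtain s where s: "?S = ereal s" by (cases ?S) auto
    with c obtain w where w: "s < w" "ereal w < c" using ereal_dense2 by (metis less_ereal.simps(1))
    define \<epsilon> where "\<epsilon> = (w - s) / 2"
    have \<epsilon>: "\<epsilon> > 0" unfolding \<epsilon>_def using w by simp
    have le: "ereal (F \<nu>) - \<alpha> \<nu> \<le> ereal s" if "\<nu> \<in> probs" for \<nu>
      unfolding s[symmetric] using that by (intro SUP_upper)
    obtain D where D: "\<And>n. n > 0 \<Longrightarrow> ?\<rho> n \<le> ereal (real n * (s + \<epsilon>) + D)"
      using rho_n_le[where \<alpha> = \<alpha> and F = F, OF assms(1,2,4,5) B le \<epsilon>] by blast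
    show "\<forall>\<^sub>F n in sequentially. ereal (1 / real n) * ?\<rho> n < c"
      using small[OF \<epsilon>, of D] eventually_gt_at_top[of 0]
    proof eventually_elim
      case (elim n)
      have "ereal (1 / real n) * ?\<rho> n \<le> ereal (1 / real n) * ereal (real n * (s + \<epsilon>) + D)"
        using D[OF elim(2)] by (intro ereal_mult_left_mono) auto
      also have "\<dots> = ereal (s + \<epsilon> + D / real n)" by (rule scale[OF elim(2)])
      also have "\<dots> < ereal w" using elim by (simp add: \<epsilon>_def field_simps)
      finally show ?case using w(2) by simp
    qed
  qed
qed

end
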